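(* Let $m$ be a positive integer. With the distributions $\partial_r^{2k}\delta$, $(\underline{\omega}\,\partial_r^{2k+1})\delta$ in $\mathbb{R}^m$, the signumdistributions $(\underline{\omega}\,\partial_r^{2k})\delta$, $\partial_r^{2k+1}\delta$, $\frac1r\partial_r^{2k}\delta$, $\frac1r\underline{\omega}\,\partial_r^{2k+1}\delta$, and the actions of $r$ and $\partial_r$ on signumdistributions as defined in the context, the following equalities of distributions hold: $$r\,\partial_r^{2k+1}\,\delta(\underline{x}) = -(m+2k)\,\partial_r^{2k}\,\delta(\underline{x}),\qquad k\ge0,$$ $$r\,(\underline{\omega}\,\partial_r^{2k})\,\delta(\underline{x}) = -(m+2k-1)\,(\underline{\omega}\,\partial_r^{2k-1})\,\delta(\underline{x}),\qquad k\ge1,$$ $$r\,\Big(\tfrac1r\,\partial_r^{2k}\delta(\underline{x})\Big)=\partial_r^{2k}\delta(\underline{x}),\qquad k\ge0,$$ $$r\,\Big(\tfrac1r\,\underline{\omega}\,\partial_r^{2k+1}\delta(\underline{x})\Big)=\underline{\omega}\,\partial_r^{2k+1}\delta(\underline{x}),\qquad k\ge0,$$ $$\partial_r\,(\partial_r^{2k+1})\,\delta(\underline{x})=\partial_r^{2k+2}\,\delta(\underline{x}),\qquad k\ge0,$$ $$\partial_r\,(\underline{\omega}\,\partial_r^{2k})\,\delta(\underline{x})=(\underline{\omega}\,\partial_r^{2k+1})\,\delta(\underline{x}),\qquad k\ge0.$$ The fourth identity holds for every value of the arbitrary constant $c_0$ entering the definition of $\frac1r\underline{\omega}\,\partial_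r^{2k+1}\delta$.
   Context: Let $\mathbb{R}_{0,m}$ be the real Clifford algebra generated by $e_1,\dots,e_m$ with $e_j^2=-1$ and $e_ie_j=-e_je_i$ for $i\neq j$. Put $\underline{x}=\sum_{j=1}^m e_jx_j$, $r=|\underline{x}|$, $\underline{\omega}=\underline{x}/|\underline{x}|$ (so $\underline{x}=r\underline{\omega}$, $\underline{\omega}^2=-1$), and let $\underline{\partial}=\sum_{j=1}^m e_j\partial_{x_j}$ be the Dirac operator. Distributions are $\mathbb{R}_{0,m}$-valued continuous linear functionals on the space $\mathcal{D}(\mathbb{R}^m)$ of real-valued test functions; $\underline{x}$ and $\underline{\partial}$ act from the left in the usual way, so $\langle\underline{\partial}\,\delta,\varphi\rangle=-(\underline{\partial}\varphi)(0)$. Signumdistributions. Let $\Omega(\mathbb{R}^m)=\{\underline{\omega}\,\varphi : \varphi\in\mathcal{D}(\mathbb{R}^m)\}$, with the topology transported from $\mathcal{D}(\mathbb{R}^m)$ by the bijection $\varphi\leftrightarrow\underline{\omega}\varphi$. A signumdistribution is a continuous linear ($\mathbb{R}_{0,m}$-valued) functional on $\Omega(\mathbb{R}^m)$. For a distribution $T$ let $\underline{\omega}T$ denote the signumdistribution $\langle\underline{\omega}T,\underline{\omega}\varphi\rangle=-\langle T,\varphi\rangle$; every signumdistribution is $\underline{\omega}T$ for exactly one distribution $T$. The distributions. For $k\ge 0$, with empty products equal to $1$, $$\partial_r^{2k}\delta=\frac{(-1)^k}{2^kk!}(m+1)(m+3)\cdots(m+2k-1)\,\underline{\partial}^{2k}\delta,\qquad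 (\underline{\omega}\,\partial_r^{2k+1})\delta=\frac{(-1)^k}{2^kk!}(m+1)(m+3)\cdots(m+2k-1)\,\underline{\partial}^{2k+1}\delta .$$ The operator $(\underline{\omega}\,\partial_r)$ acts on them by $(\underline{\omega}\,\partial_r)\,\partial_r^{2k}\delta=(\underline{\omega}\,\partial_r^{2k+1})\delta$ and $(\underline{\omega}\,\partial_r)(\underline{\omega}\,\partial_r^{2k+1})\delta=-\partial_r^{2k+2}\delta$, extended linearly. The signumdistributions. For $k\ge0$: $(\underline{\omega}\,\partial_r^{2k})\delta=\underline{\omega}(\partial_r^{2k}\delta)$ and $\partial_r^{2k+1}\delta=-\underline{\omega}\big((\underline{\omega}\,\partial_r^{2k+1})\delta\big)$. Division by $r$. The signumdistribution $\frac1rT$ is defined by $\langle\frac1rT,\underline{\omega}\varphi\rangle=-\langle\frac{1}{\underline{x}}T,\varphi\rangle$, where $$\frac{1}{\underline{x}}\,\underline{\partial}^{2k}\delta=\frac{1}{m+2k}\,\underline{\partial}^{2k+1}\delta,\qquad \frac{1}{\underline{x}}\,\underline{\partial}^{2k+1}\delta=\frac{1}{2k+2}\,\underline{\partial}^{2k+2}\delta+c_0\,\delta$$ with $c_0$ an arbitrary real constant. Equivalently, $$\frac1r\,\partial_r^{2k}\delta=-\frac{1}{m+2k}\,\partial_r^{2k+1}\delta,\qquad \frac1r\,(\underline{\omega}\,\partial_r^{2k+1})\delta=-\frac{1}{m+2k+1}\,(\underline{\omega}\,\partial_r^{2k+2})\delta+(\underline{\omega}\,\delta)\,c_0$$ ($c_0$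 again arbitrary). Actions of $r$ and $\partial_r$ on signumdistributions, giving distributions. For a signumdistribution $\underline{\omega}T$ put $r(\underline{\omega}T)=\underline{x}\,T$; for $T$ in the linear span of the distributions $\partial_r^{2k}\delta$, $(\underline{\omega}\,\partial_r^{2k+1})\delta$ ($k\ge0$) put $\partial_r(\underline{\omega}T)=(\underline{\omega}\,\partial_r)T$. *)

theory Defs
  imports "HOL-Analysis.Analysis"
begin

text \<open>
  The Clifford algebra of signature \<open>(0, m)\<close> with \<open>m = CARD('n)\<close>. An element is stored as its
  coefficients with respect to the blades \<open>e\<^sub>A = e\<^bsub>i\<^sub>1\<^esub> \<cdots> e\<^bsub>i\<^sub>p\<^esub>\<close> for
  \<open>A = {i\<^sub>1 < \<dots> < i\<^sub>p}\<close>.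
\<close>

typedef ('n::finite) clifford = "UNIV :: ('n set \<Rightarrow> real) set"
  morphisms coeff Clifford ..

setup_lifting type_definition_clifford

text \<open>
  \<open>e\<^sub>A e\<^sub>B = blade_sign A B \<cdot> e\<^bsub>A \<triangle> B\<^esub>\<close>: the pairs with \<open>b < a\<close> count the transpositions needed
  to sort the product, the pairs with \<open>b = a\<close> the cancellations \<open>e\<^sub>a\<^sup>2 = -1\<close>.
\<close>

definition blade_sign :: "('n::{finite,linorder}) set \<Rightarrow> 'n set \<Rightarrow> real"
  where "blade_sign A B = (-1) ^ card {(a, b). a \<in> A \<and> b \<in> B \<and> b \<le> a}"

lemma blade_sign_prod:
  "blade_sign A B = (\<Prod>a\<in>A. \<Prod>b\<in>B. if b \<le> a then -1 else 1)"
proof -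
  have "(\<Prod>a\<in>A. \<Prod>b\<in>B. if b \<le> a then -1 else 1 :: real)
        = (\<Prod>p\<in>A\<times>B. if snd p \<le> fst p then -1 else 1)"
    by (simp add: prod.cartesian_product case_prod_beta)
  also have "\<dots> = (\<Prod>p\<in>{p\<in>A\<times>B. snd p \<le> fst p}. -1)"
    by (rule prod.inter_filter [symmetric]) simp
  also have "\<dots> = (-1) ^ card {p\<in>A\<times>B. snd p \<le> fst p}"
    by simp
  also have "{p\<in>A\<times>B. snd p \<le> fst p} = {(a, b). a \<in> A \<and> b \<in> B \<and> b \<le> a}"
    by auto
  finally show ?thesis
    by (simp add: blade_sign_def)
qed

lemma prod_sym_diff:
  fixes f :: "'a::finite \<Rightarrow> real"
  assumes "\<And>a. f a * f a = 1"
  shows "prod f (sym_diff A B) = prod f A * prod f B"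
proof -
  have *: "prod f (A \<inter> B) * prod f (A \<inter> B) = 1"
    by (simp add: prod.distrib [symmetric] assms)
  have "prod f A = prod f (A - B) * prod f (A \<inter> B)"
    by (subst prod.union_disjoint [symmetric]) (auto intro!: prod.cong)
  moreover have "prod f B = prod f (B - A) * prod f (A \<inter> B)"
    by (subst prod.union_disjoint [symmetric]) (auto intro!: prod.cong)
  moreover have "prod f (sym_diff A B) = prod f (A - B) * prod f (B - A)"
    by (subst prod.union_disjoint) auto
  ultimately have "prod f A * prod f B = prod f (sym_diff A B) * (prod f (A \<inter> B) * prod f (A \<inter> B))"
    by (simp only: mult_ac)
  with * show ?thesis
    by simp
qed

lemma blade_sign_sym_diff:
  "blade_sign (sym_diff A B) C = blade_sign A C * blade_sign B C"
  "blade_sign A (sym_diff B C) = blade_sign A B * blade_sign A C"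
  unfolding blade_sign_prod
   apply (rule prod_sym_diff)
   apply (auto simp: prod.distrib [symmetric] intro!: prod.neutral)[1]
  apply (subst prod_sym_diff)
   apply auto[1]
  apply (simp add: prod.distrib)
  done

lemma blade_sign_empty [simp]: "blade_sign {} A = 1" "blade_sign A {} = 1"
  by (simp_all add: blade_sign_prod)

lemma abs_blade_sign [simp]: "\<bar>blade_sign A B\<bar> = 1"
  by (simp add: blade_sign_def power_abs)

lemma sym_diff_assoc: "sym_diff (sym_diff A B) C = sym_diff A (sym_diff B C)"
  and sym_diff_cancel [simp]: "sym_diff A (sym_diff A B) = B"
  by blast+

lemma bij_sym_diff: "bij (\<lambda>B. sym_diff A B)"
  by (rule o_bij [of "\<lambda>B. sym_diff A B"]) (simp_all add: fun_eq_iff)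

lemma bij_sym_diff': "bij (\<lambda>B. sym_diff B A)"
  using bij_sym_diff [of A] by (simp add: Un_commute)

instantiation clifford :: (finite) real_vector
begin

lift_definition zero_clifford :: "'a clifford" is "\<lambda>_. 0" .
lift_definition plus_clifford :: "'a clifford \<Rightarrow> 'a clifford \<Rightarrow> 'a clifford"
  is "\<lambda>x y A. x A + y A" .
lift_definition minus_clifford :: "'a clifford \<Rightarrow> 'a clifford \<Rightarrow> 'a clifford"
  is "\<lambda>x y A. x A - y A" .
lift_definition uminus_clifford :: "'a clifford \<Rightarrow> 'a clifford"
  is "\<lambda>x A. - x A" .
lift_definition scaleR_clifford :: "real \<Rightarrow> 'a clifford \<Rightarrow> 'a clifford"
  is "\<lambda>c x A. c * x A" .

instance
  by standard (transfer; simp add: fun_eq_iff algebra_simps)+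

end

text \<open>
  In the product, \<open>B = A \<triangle> C\<close> is the only \<open>B\<close> with \<open>A \<triangle> B = C\<close>. The norm serves only to give
  the (unique) vector space topology; the \<open>l\<^sup>1\<close> norm of the coefficients is chosen because it is
  submultiplicative.
\<close>

instantiation clifford :: ("{finite,linorder}") real_normed_algebra_1
begin

lift_definition one_clifford :: "'a clifford" is "\<lambda>A. if A = {} then 1 else 0" .
lift_definition times_clifford :: "'a clifford \<Rightarrow> 'a clifford \<Rightarrow> 'a clifford"
  is "\<lambda>x y C. \<Sum>A\<in>UNIV. blade_sign A (sym_diff A C) * x A * y (sym_diff A C)" .

lift_definition norm_clifford :: "'a clifford \<Rightarrow> real" is "\<lambda>x. \<Sum>A\<in>UNIV. \<bar>x A\<bar>" .
definition dist_clifford :: "'a clifford \<Rightarrow> 'a clifford \<Rightarrow> real"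
  where "dist_clifford x y = norm (x - y)"
definition sgn_clifford :: "'a clifford \<Rightarrow> 'a clifford"
  where "sgn_clifford x = inverse (norm x) *\<^sub>R x"
definition uniformity_clifford :: "('a clifford \<times> 'a clifford) filter"
  where "uniformity_clifford = (INF e\<in>{0<..}. principal {(x, y). dist x y < e})"
definition open_clifford :: "'a clifford set \<Rightarrow> bool"
  where "open_clifford U \<longleftrightarrow> (\<forall>x\<in>U. \<forall>\<^sub>F (x', y) in uniformity. x' = x \<longrightarrow> y \<in> U)"

instance
proof
  fix a b c x y z :: "'a clifford" and r :: real and U :: "'a clifford set"
  show "a * b * c = a * (b * c)"
  proof (transfer, rule ext)
    fix a b c :: "'a set \<Rightarrow> real" and D :: "'a set"
    have "(\<Sum>C\<in>UNIV. blade_sign C (sym_diff C D) *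
            (\<Sum>A\<in>UNIV. blade_sign A (sym_diff A C) * a A * b (sym_diff A C)) * c (sym_diff C D))
        = (\<Sum>A\<in>UNIV. \<Sum>C\<in>UNIV. blade_sign C (sym_diff C D) * blade_sign A (sym_diff A C) *
             a A * b (sym_diff A C) * c (sym_diff C D))"
      by (subst sum.swap) (simp add: sum_distrib_left sum_distrib_right mult_ac)
    also have "\<dots> = (\<Sum>A\<in>UNIV. \<Sum>B\<in>UNIV. blade_sign (sym_diff A B) (sym_diff (sym_diff A B) D) *
             blade_sign A (sym_diff A (sym_diff A B)) *
             a A * b (sym_diff A (sym_diff A B)) * c (sym_diff (sym_diff A B) D))"
      by (rule sum.cong [OF refl], rule sum.reindex_bij_betw [symmetric], rule bij_sym_diff)
    also have "\<dots> = (\<Sum>A\<in>UNIV. \<Sum>B\<in>UNIV. blade_sign A (sym_diff A D) * a A *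
             (blade_sign B (sym_diff B (sym_diff A D)) * b B * c (sym_diff B (sym_diff A D))))"
    proof (intro sum.cong refl)
      fix A B
      define E where "E = sym_diff (sym_diff A B) D"
      have 1: "sym_diff B (sym_diff A D) = E" and 2: "sym_diff A D = sym_diff B E"
        unfolding E_def by blast+
      show "blade_sign (sym_diff A B) (sym_diff (sym_diff A B) D) *
             blade_sign A (sym_diff A (sym_diff A B)) *
             a A * b (sym_diff A (sym_diff A B)) * c (sym_diff (sym_diff A B) D)
          = blade_sign A (sym_diff A D) * a A *
             (blade_sign B (sym_diff B (sym_diff A D)) * b B * c (sym_diff B (sym_diff A D)))"
        unfolding sym_diff_cancel 1 E_def [symmetric]
        unfolding 2 by (simp only: blade_sign_sym_diff mult_ac)
    qed
    finally show "(\<Sum>C\<in>UNIV. blade_sign C (sym_diff C D) *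
            (\<Sum>A\<in>UNIV. blade_sign A (sym_diff A C) * a A * b (sym_diff A C)) * c (sym_diff C D))
       = (\<Sum>A\<in>UNIV. blade_sign A (sym_diff A D) * a A *
          (\<Sum>B\<in>UNIV. blade_sign B (sym_diff B (sym_diff A D)) * b B * c (sym_diff B (sym_diff A D))))"
      by (simp only: sum_distrib_left)
  qed
  show "(a + b) * c = a * c + b * c" "a * (b + c) = a * b + a * c"
    by (transfer; simp add: fun_eq_iff algebra_simps sum.distrib)+
  show "r *\<^sub>R a * b = r *\<^sub>R (a * b)" "a * r *\<^sub>R b = r *\<^sub>R (a * b)"
    by (transfer; simp add: fun_eq_iff sum_distrib_left mult_ac)+
  show "1 * a = a"
  proof (transfer, rule ext)
    fix a :: "'a set \<Rightarrow> real" and C :: "'a set"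
    have "(\<Sum>A\<in>UNIV. blade_sign A (sym_diff A C) * (if A = {} then 1 else 0) * a (sym_diff A C))
        = (\<Sum>A\<in>(UNIV :: 'a set set). if A = {} then a C else 0)"
      by (rule sum.cong) auto
    then show "(\<Sum>A\<in>UNIV. blade_sign A (sym_diff A C) * (if A = {} then 1 else 0) * a (sym_diff A C)) = a C"
      by simp
  qed
  show "a * 1 = a"
  proof (transfer, rule ext)
    fix a :: "'a set \<Rightarrow> real" and C :: "'a set"
    have "sym_diff A C = {} \<longleftrightarrow> A = C" for A
      by blast
    then have "(\<Sum>A\<in>UNIV. blade_sign A (sym_diff A C) * a A * (if sym_diff A C = {} then 1 else 0))
        = (\<Sum>A\<in>UNIV. if A = C then a C else 0)"
      by (intro sum.cong) auto
    then show "(\<Sum>A\<in>UNIV. blade_sign A (sym_diff A C) * a A * (if sym_diff A C = {} then 1 else 0)) = a C"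
      by simp
  qed
  show "(0::'a clifford) \<noteq> 1"
    by transfer (metis zero_neq_one)
  show "dist x y = norm (x - y)"
    by (rule dist_clifford_def)
  show "sgn x = x /\<^sub>R norm x"
    by (rule sgn_clifford_def)
  show "(uniformity :: ('a clifford \<times> 'a clifford) filter) = (INF e\<in>{0<..}. principal {(x, y). dist x y < e})"
    by (rule uniformity_clifford_def)
  show "open U = (\<forall>x\<in>U. \<forall>\<^sub>F (x', y) in uniformity. x' = x \<longrightarrow> y \<in> U)"
    by (rule open_clifford_def)
  show "(norm x = 0) = (x = 0)"
    by transfer (simp add: sum_nonneg_eq_0_iff fun_eq_iff)
  show "norm (x + y) \<le> norm x + norm y"
    by transfer (simp add: sum.distrib [symmetric] sum_mono abs_triangle_ineq)
  show "norm (r *\<^sub>R x) = \<bar>r\<bar> * norm x"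
    by transfer (simp add: abs_mult sum_distrib_left)
  show "norm (1::'a clifford) = 1"
  proof transfer
    have "(\<Sum>A\<in>(UNIV::'a set set). \<bar>if A = {} then 1 else 0::real\<bar>) = (\<Sum>A\<in>(UNIV :: 'a set set). if A = {} then 1 else 0)"
      by (rule sum.cong) auto
    then show "(\<Sum>A\<in>(UNIV::'a set set). \<bar>if A = {} then 1 else 0::real\<bar>) = 1"
      by simp
  qed
  show "norm (x * y) \<le> norm x * norm y"
  proof transfer
    fix x y :: "'a set \<Rightarrow> real"
    have "(\<Sum>C\<in>UNIV. \<bar>\<Sum>A\<in>UNIV. blade_sign A (sym_diff A C) * x A * y (sym_diff A C)\<bar>)
        \<le> (\<Sum>C\<in>UNIV. \<Sum>A\<in>UNIV. \<bar>x A\<bar> * \<bar>y (sym_diff A C)\<bar>)"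
      by (rule sum_mono, rule order_trans, rule sum_abs) (simp add: abs_mult)
    also have "\<dots> = (\<Sum>A\<in>UNIV. \<bar>x A\<bar> * (\<Sum>C\<in>UNIV. \<bar>y (sym_diff A C)\<bar>))"
      by (subst sum.swap) (simp add: sum_distrib_left)
    also have "\<dots> = (\<Sum>A\<in>UNIV. \<bar>x A\<bar> * (\<Sum>B\<in>UNIV. \<bar>y B\<bar>))"
      by (simp only: sum.reindex_bij_betw [OF bij_sym_diff, of "\<lambda>B. \<bar>y B\<bar>"])
    also have "\<dots> = (\<Sum>A\<in>UNIV. \<bar>x A\<bar>) * (\<Sum>B\<in>UNIV. \<bar>y B\<bar>)"
      by (rule sum_distrib_right [symmetric])
    finally show "(\<Sum>C\<in>UNIV. \<bar>\<Sum>A\<in>UNIV. blade_sign A (sym_diff A C) * x A * y (sym_diff A C)\<bar>)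
      \<le> (\<Sum>A\<in>UNIV. \<bar>x A\<bar>) * (\<Sum>B\<in>UNIV. \<bar>y B\<bar>)" .
  qed
qed

end

lift_definition blade :: "('n::finite) set \<Rightarrow> 'n clifford" is "\<lambda>A B. if B = A then 1 else 0" .

abbreviation gen :: "'n::finite \<Rightarrow> 'n clifford" where "gen j \<equiv> blade {j}"

lemma blade_mult: "blade A * blade B = blade_sign A B *\<^sub>R blade (sym_diff A B)"
proof (transfer, rule ext)
  fix A B C :: "'a set"
  have "sym_diff A C = B \<longleftrightarrow> C = sym_diff A B"
    by blast
  then have "(\<Sum>D\<in>UNIV. blade_sign D (sym_diff D C) * (if D = A then 1 else 0) * (if sym_diff D C = B then 1 else 0))
     = (\<Sum>D\<in>UNIV. if D = A then blade_sign A B * (if C = sym_diff A B then 1 else 0) else 0)"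
    by (intro sum.cong) auto
  then show "(\<Sum>D\<in>UNIV. blade_sign D (sym_diff D C) * (if D = A then 1 else 0) * (if sym_diff D C = B then 1 else 0))
     = blade_sign A B * (if C = sym_diff A B then 1 else 0)"
    by simp
qed

lemma blade_empty: "blade {} = 1"
  by transfer (simp add: fun_eq_iff)

lemma gen_square: "gen j * gen j = -1"
  by (simp add: blade_mult blade_sign_prod blade_empty)

lemma gen_anticommute: "i \<noteq> j \<Longrightarrow> gen i * gen j = - (gen j * gen i)"
  by (cases "i < j") (auto simp: blade_mult blade_sign_prod Un_commute insert_commute insert_Diff_if)

definition partial :: "'n::finite \<Rightarrow> (real^'n \<Rightarrow> real) \<Rightarrow> (real^'n \<Rightarrow> real)"
  where "partial i f x = frechet_derivative f (at x) (axis i 1)"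

abbreviation partials :: "'n::finite list \<Rightarrow> (real^'n \<Rightarrow> real) \<Rightarrow> (real^'n \<Rightarrow> real)"
  where "partials is \<equiv> foldr partial is"

text \<open>
  A function is \<open>C\<^sup>\<infinity>\<close> iff all its iterated partial derivatives are differentiable (hence continuous).
\<close>

definition smooth :: "(real^'n::finite \<Rightarrow> real) \<Rightarrow> bool"
  where "smooth f \<longleftrightarrow> (\<forall>is x. partials is f differentiable (at x))"

lemma smoothD: "smooth f \<Longrightarrow> partials is f differentiable (at x)"
  by (simp add: smooth_def)

lemma smooth_partial: "smooth f \<Longrightarrow> smooth (partial i f)"
  unfolding smooth_def
proof (intro allI)
  fix "is" x
  assume "\<forall>is x. partials is f differentiable (at x)"
  then have "partials (is @ [i]) f differentiable (at x)"
    by blast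
  then show "partials is (partial i f) differentiable (at x)"
    by simp
qed

lemma partial_add:
  assumes "f differentiable (at x)" "g differentiable (at x)"
  shows "partial i (\<lambda>x. f x + g x) x = partial i f x + partial i g x"
proof -
  have "((\<lambda>x. f x + g x) has_derivative
      (\<lambda>h. frechet_derivative f (at x) h + frechet_derivative g (at x) h)) (at x)"
    by (intro has_derivative_add) (use assms in \<open>simp_all add: frechet_derivative_works [symmetric]\<close>)
  from frechet_derivative_at [OF this, symmetric] show ?thesis
    by (simp add: partial_def)
qed

lemma partial_cmult:
  assumes "f differentiable (at x)"
  shows "partial i (\<lambda>x. c * f x) x = c * partial i f x"
proof -
  have "((\<lambda>x. c * f x) has_derivative (\<lambda>h. c * frechet_derivative f (at x) h)) (at x)"
    by (intro has_derivative_mult_right) (use assms in \<open>simp add: frechet_derivative_works [symmetric]\<close>)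
  from frechet_derivative_at [OF this, symmetric] show ?thesis
    by (simp add: partial_def)
qed

lemma partial_mult:
  assumes "f differentiable (at x)" "g differentiable (at x)"
  shows "partial i (\<lambda>x. f x * g x) x = f x * partial i g x + partial i f x * g x"
proof -
  have "((\<lambda>x. f x * g x) has_derivative
      (\<lambda>h. f x * frechet_derivative g (at x) h + frechet_derivative f (at x) h * g x)) (at x)"
    by (intro has_derivative_mult) (use assms in \<open>simp_all add: frechet_derivative_works [symmetric]\<close>)
  from frechet_derivative_at [OF this, symmetric] show ?thesis
    by (simp add: partial_def)
qed

lemma has_derivative_coord: "((\<lambda>x::real^'n::finite. x $ j) has_derivative (\<lambda>h. h $ j)) (at x)"
  by (rule bounded_linear_imp_has_derivative) (rule bounded_linear_vec_nth)

lemma differentiable_coord: "(\<lambda>x::real^'n::finite. x $ j) differentiable (at x)"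
  by (rule differentiableI [OF has_derivative_coord])

lemma partial_coord: "partial i (\<lambda>x::real^'n::finite. x $ j) x = (if i = j then 1 else 0)"
  using frechet_derivative_at [OF has_derivative_coord [of j x], symmetric]
  by (simp add: partial_def axis_def)

lemma partials_zero: "partials is (\<lambda>_. 0) = (\<lambda>_. 0 :: real)"
proof (induction "is")
  case (Cons i "is")
  show ?case by (rule ext) (simp add: Cons.IH, simp add: partial_def)
qed simp

lemma partials_add:
  assumes "smooth f" "smooth g"
  shows "partials is (\<lambda>x. f x + g x) = (\<lambda>x. partials is f x + partials is g x)"
proof (induction "is")
  case (Cons i "is")
  show ?case by (rule ext) (simp add: Cons.IH partial_add smoothD assms)
qed simp

lemma partials_cmult:
  assumes "smooth f"
  shows "partials is (\<lambda>x. c * f x) = (\<lambda>x. c * partials is f x)"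
proof (induction "is")
  case (Cons i "is")
  show ?case by (rule ext) (simp add: Cons.IH partial_cmult smoothD assms)
qed simp

lemma partial_sum_list:
  assumes "\<And>l. l \<in> set L \<Longrightarrow> F l differentiable (at x)"
  shows "(\<lambda>x. \<Sum>l\<leftarrow>L. F l x) differentiable (at x) \<and>
    partial i (\<lambda>x. \<Sum>l\<leftarrow>L. F l x) x = (\<Sum>l\<leftarrow>L. partial i (F l) x)"
  using assms by (induction L) (auto simp: partial_add partial_def [of _ "\<lambda>_. 0"])

lemma partials_coord_mult_ex:
  fixes "is" :: "'n::finite list"
  shows "\<exists>L. (\<forall>l\<in>set L. length l \<le> length is) \<and> (\<forall>f. smooth f \<longrightarrow>
    partials is (\<lambda>x. x $ j * f x) = (\<lambda>x. x $ j * partials is f x + (\<Sum>l\<leftarrow>L. partials l f x)))"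
proof (induction "is")
  case Nil
  show ?case by (rule exI [of _ "[]"]) simp
next
  case (Cons i "is")
  then obtain L where L: "\<And>l. l \<in> set L \<Longrightarrow> length l \<le> length is"
    "\<And>f. smooth f \<Longrightarrow>
      partials is (\<lambda>x. x $ j * f x) = (\<lambda>x. x $ j * partials is f x + (\<Sum>l\<leftarrow>L. partials l f x))"
    by blast
  define L' where "L' = (if i = j then [is] else []) @ map ((#) i) L"
  have "partials (i # is) (\<lambda>x. x $ j * f x)
      = (\<lambda>x. x $ j * partials (i # is) f x + (\<Sum>l\<leftarrow>L'. partials l f x))" if f: "smooth f" for f
  proof
    fix x
    have s: "(\<lambda>x. \<Sum>l\<leftarrow>L. partials l f x) differentiable (at x)"
      "partial i (\<lambda>x. \<Sum>l\<leftarrow>L. partials l f x) x = (\<Sum>l\<leftarrow>L. partial i (partials l f) x)"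
      using partial_sum_list [of L "\<lambda>l. partials l f" x i] smoothD [OF f] by blast+
    have "partial i (\<lambda>x. x $ j * partials is f x + (\<Sum>l\<leftarrow>L. partials l f x)) x
      = x $ j * partial i (partials is f) x + (if i = j then 1 else 0) * partials is f x
        + (\<Sum>l\<leftarrow>L. partial i (partials l f) x)"
      using smoothD [OF f, of "is" x] differentiable_coord [of j x] s
      by (subst partial_add) (auto simp: partial_mult partial_coord intro: differentiable_mult)
    then show "partials (i # is) (\<lambda>x. x $ j * f x) x
      = x $ j * partials (i # is) f x + (\<Sum>l\<leftarrow>L'. partials l f x)"
      by (simp add: L(2) [OF f] L'_def o_def)
  qed
  moreover have "\<forall>l\<in>set L'. length l \<le> length (i # is)"
    using L(1) by (auto simp: L'_def)
  ultimately show ?case by blast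
qed

lemma smooth_zero: "smooth (\<lambda>_. 0)"
  by (simp add: smooth_def partials_zero)

lemma smooth_add: "smooth f \<Longrightarrow> smooth g \<Longrightarrow> smooth (\<lambda>x. f x + g x)"
  unfolding smooth_def [of "\<lambda>x. f x + g x"] by (simp add: partials_add smoothD)

lemma smooth_cmult: "smooth f \<Longrightarrow> smooth (\<lambda>x. c * f x)"
  unfolding smooth_def [of "\<lambda>x. c * f x"] by (simp add: partials_cmult smoothD)

lemma smooth_coord_mult:
  fixes f :: "real^'n::finite \<Rightarrow> real"
  assumes f: "smooth f"
  shows "smooth (\<lambda>x. x $ j * f x)"
  unfolding smooth_def
proof (intro allI)
  fix "is" :: "'n list" and x
  obtain L where "partials is (\<lambda>x. x $ j * f x) = (\<lambda>x. x $ j * partials is f x + (\<Sum>l\<leftarrow>L. partials l f x))"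
    using partials_coord_mult_ex [of "is" j] f by blast
  moreover have "(\<lambda>x. \<Sum>l\<leftarrow>L. partials l f x) differentiable (at x)"
    using partial_sum_list [of L "\<lambda>l. partials l f" x] smoothD [OF f] by blast
  ultimately show "partials is (\<lambda>x. x $ j * f x) differentiable (at x)"
    using smoothD [OF f, of "is" x] differentiable_coord [of j x] by simp
qed

abbreviation supp :: "(real^'n::finite \<Rightarrow> real) \<Rightarrow> (real^'n) set"
  where "supp f \<equiv> closure {x. f x \<noteq> 0}"

lemma supp_partial: "supp (partial i f) \<subseteq> supp f"
proof (rule closure_minimal)
  show "{x. partial i f x \<noteq> 0} \<subseteq> supp f"
  proof
    fix x assume "x \<in> {x. partial i f x \<noteq> 0}"
    show "x \<in> supp f"
    proof (rule ccontr)
      assume x: "x \<notin> supp f"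
      have "(f has_derivative (\<lambda>_. 0)) (at x)"
        by (rule has_derivative_transform_within_open [of "\<lambda>_. 0" _ _ _ "- supp f"])
          (use x closure_subset [of "{x. f x \<noteq> 0}"] in auto)
      from frechet_derivative_at [OF this, symmetric] have "partial i f x = 0"
        by (simp add: partial_def)
      with \<open>x \<in> {x. partial i f x \<noteq> 0}\<close> show False by simp
    qed
  qed
qed simp

typedef ('n::finite) test_fun = "{\<phi>::real^'n \<Rightarrow> real. smooth \<phi> \<and> compact (supp \<phi>)}"
  morphisms test_apply Test_fun
  by (rule exI [of _ "\<lambda>_. 0"]) (simp add: smooth_zero)

setup_lifting type_definition_test_fun

lemma compact_supp_add:
  assumes "compact (supp f)" "compact (supp g)"
  shows "compact (supp (\<lambda>x. f x + g x))"
proof -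
  have "bounded ({x. f x \<noteq> 0} \<union> {x. g x \<noteq> 0})"
    using assms by simp
  then show ?thesis
    unfolding compact_closure by (rule bounded_subset) auto
qed

lemma compact_supp_mult:
  assumes "compact (supp f)"
  shows "compact (supp (\<lambda>x. g x * f x))"
  using assms unfolding compact_closure by (rule bounded_subset) auto

lemma compact_supp_partial:
  assumes "compact (supp f)"
  shows "compact (supp (partial i f))"
  using compact_Int_closed [OF assms, of "supp (partial i f)"] supp_partial [of i f]
  by (simp only: closed_closure Int_absorb1)

instantiation test_fun :: (finite) real_vector
begin

lift_definition zero_test_fun :: "'a test_fun" is "\<lambda>_. 0"
  by (simp add: smooth_zero)
lift_definition plus_test_fun :: "'a test_fun \<Rightarrow> 'a test_fun \<Rightarrow> 'a test_fun"
  is "\<lambda>\<phi> \<psi> x. \<phi> x + \<psi> x"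
  by (intro conjI smooth_add compact_supp_add) auto
lift_definition uminus_test_fun :: "'a test_fun \<Rightarrow> 'a test_fun" is "\<lambda>\<phi> x. - \<phi> x"
proof -
  fix \<phi> :: "real^'a \<Rightarrow> real"
  assume "smooth \<phi> \<and> compact (supp \<phi>)"
  then have "smooth (\<lambda>x. - 1 * \<phi> x) \<and> compact (supp (\<lambda>x. - 1 * \<phi> x))"
    by (intro conjI smooth_cmult compact_supp_mult) auto
  then show "smooth (\<lambda>x. - \<phi> x) \<and> compact (supp (\<lambda>x. - \<phi> x))"
    by (simp only: mult_minus1)
qed
lift_definition minus_test_fun :: "'a test_fun \<Rightarrow> 'a test_fun \<Rightarrow> 'a test_fun"
  is "\<lambda>\<phi> \<psi> x. \<phi> x - \<psi> x"
proof -
  fix \<phi> \<psi> :: "real^'a \<Rightarrow> real"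
  assume "smooth \<phi> \<and> compact (supp \<phi>)" "smooth \<psi> \<and> compact (supp \<psi>)"
  then have "smooth (\<lambda>x. \<phi> x + - 1 * \<psi> x) \<and> compact (supp (\<lambda>x. \<phi> x + - 1 * \<psi> x))"
    by (intro conjI smooth_add smooth_cmult compact_supp_add compact_supp_mult) auto
  then show "smooth (\<lambda>x. \<phi> x - \<psi> x) \<and> compact (supp (\<lambda>x. \<phi> x - \<psi> x))"
    by (simp only: mult_minus1 add_uminus_conv_diff)
qed
lift_definition scaleR_test_fun :: "real \<Rightarrow> 'a test_fun \<Rightarrow> 'a test_fun" is "\<lambda>c \<phi> x. c * \<phi> x"
  by (intro conjI smooth_cmult compact_supp_mult) auto

instance
  by standard (transfer; simp add: fun_eq_iff algebra_simps)+

end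

lift_definition test_partial :: "'n::finite \<Rightarrow> 'n test_fun \<Rightarrow> 'n test_fun" is partial
  by (intro conjI smooth_partial compact_supp_partial) auto

lift_definition test_coord_mult :: "'n::finite \<Rightarrow> 'n test_fun \<Rightarrow> 'n test_fun"
  is "\<lambda>j \<phi> x. x $ j * \<phi> x"
  by (intro conjI smooth_coord_mult compact_supp_mult) auto

lemma linear_test_partial: "linear (test_partial i)"
  by (rule linearI; transfer; simp add: fun_eq_iff partial_add partial_cmult smoothD [of _ "[]", simplified])

lemma linear_test_coord_mult: "linear (test_coord_mult j)"
  by (rule linearI; transfer; simp add: fun_eq_iff algebra_simps)

text \<open>
  The canonical topology of the space of test functions, that is, the finest locally convex topology
  for which the inclusions of the Frechet spaces of test functions supported in a fixed compact \<open>K\<close>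
  are all continuous. Its basic neighbourhoods of \<open>0\<close> are the absolutely convex sets that meet each
  of these Frechet spaces in a neighbourhood of \<open>0\<close>.
\<close>

definition test_nbhd0 :: "'n::finite test_fun set \<Rightarrow> bool"
  where "test_nbhd0 V \<longleftrightarrow> convex V \<and> (\<forall>\<psi>\<in>V. - \<psi> \<in> V) \<and>
    (\<forall>K. compact K \<longrightarrow> (\<exists>N. \<exists>\<epsilon>>0. \<forall>\<psi>.
      supp (test_apply \<psi>) \<subseteq> K \<and>
      (\<forall>is x. length is \<le> N \<longrightarrow> \<bar>partials is (test_apply \<psi>) x\<bar> < \<epsilon>) \<longrightarrow> \<psi> \<in> V))"

lemma test_nbhd0_Int:
  assumes "test_nbhd0 V" "test_nbhd0 W"
  shows "test_nbhd0 (V \<inter> W)"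
  unfolding test_nbhd0_def
proof (intro conjI allI impI)
  show "convex (V \<inter> W)" "\<forall>\<psi>\<in>V \<inter> W. - \<psi> \<in> V \<inter> W"
    using assms by (auto simp: test_nbhd0_def convex_Int)
  fix K :: "(real^'a) set"
  assume K: "compact K"
  from assms(1) K obtain M d where M: "d > 0" "\<And>\<psi>. supp (test_apply \<psi>) \<subseteq> K \<Longrightarrow>
      (\<And>is x. length is \<le> M \<Longrightarrow> \<bar>partials is (test_apply \<psi>) x\<bar> < d) \<Longrightarrow> \<psi> \<in> V"
    unfolding test_nbhd0_def by metis
  from assms(2) K obtain N e where N: "e > 0" "\<And>\<psi>. supp (test_apply \<psi>) \<subseteq> K \<Longrightarrow>
      (\<And>is x. length is \<le> N \<Longrightarrow> \<bar>partials is (test_apply \<psi>) x\<bar> < e) \<Longrightarrow> \<psi> \<in> W"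
    unfolding test_nbhd0_def by metis
  show "\<exists>N. \<exists>\<epsilon>>0. \<forall>\<psi>. supp (test_apply \<psi>) \<subseteq> K \<and>
      (\<forall>is x. length is \<le> N \<longrightarrow> \<bar>partials is (test_apply \<psi>) x\<bar> < \<epsilon>) \<longrightarrow> \<psi> \<in> V \<inter> W"
    by (rule exI [of _ "max M N"], rule exI [of _ "min d e"]) (use M N in auto)
qed

lemma test_nbhd0_UNIV: "test_nbhd0 UNIV"
  unfolding test_nbhd0_def by (auto intro: exI [of _ 1])

instantiation test_fun :: (finite) topological_space
begin

definition open_test_fun :: "'a test_fun set \<Rightarrow> bool"
  where "open_test_fun U \<longleftrightarrow> (\<forall>\<phi>\<in>U. \<exists>V. test_nbhd0 V \<and> (\<forall>\<psi>\<in>V. \<phi> + \<psi> \<in> U))"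

instance
proof
  show "open (UNIV :: 'a test_fun set)"
    using test_nbhd0_UNIV by (auto simp: open_test_fun_def)
next
  fix S T :: "'a test_fun set"
  assume S: "open S" and T: "open T"
  show "open (S \<inter> T)"
    unfolding open_test_fun_def
  proof
    fix \<phi> assume "\<phi> \<in> S \<inter> T"
    with S T obtain V W where "test_nbhd0 V" "\<forall>\<psi>\<in>V. \<phi> + \<psi> \<in> S" "test_nbhd0 W" "\<forall>\<psi>\<in>W. \<phi> + \<psi> \<in> T"
      unfolding open_test_fun_def by blast
    then show "\<exists>V. test_nbhd0 V \<and> (\<forall>\<psi>\<in>V. \<phi> + \<psi> \<in> S \<inter> T)"
      by (intro exI [of _ "V \<inter> W"]) (simp add: test_nbhd0_Int)
  qed
next
  fix \<U> :: "'a test_fun set set"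
  assume "\<forall>S\<in>\<U>. open S"
  then show "open (\<Union>\<U>)"
    unfolding open_test_fun_def by (meson UnionE UnionI)
qed

end

lemma continuous_linear_into_normed:
  fixes T :: "'n::finite test_fun \<Rightarrow> 'b::real_normed_vector"
  assumes T: "linear T"
    and bound: "\<And>K. compact K \<Longrightarrow> \<exists>N C. \<forall>\<psi> e. supp (test_apply \<psi>) \<subseteq> K \<longrightarrow>
      (\<forall>is x. length is \<le> N \<longrightarrow> \<bar>partials is (test_apply \<psi>) x\<bar> < e) \<longrightarrow> norm (T \<psi>) \<le> C * e"
  shows "continuous_on UNIV T"
  unfolding continuous_on_open_vimage [OF open_UNIV]
proof (intro allI impI)
  fix B :: "'b set"
  assume B: "open B"
  have "\<exists>V. test_nbhd0 V \<and> (\<forall>\<psi>\<in>V. \<phi> + \<psi> \<in> T -` B)" if "T \<phi> \<in> B" for \<phi>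
  proof -
    obtain e where e: "e > 0" "ball (T \<phi>) e \<subseteq> B"
      using B \<open>T \<phi> \<in> B\<close> open_contains_ball by blast
    have "test_nbhd0 (T -` ball 0 e)"
      unfolding test_nbhd0_def
    proof (intro conjI allI impI ballI)
      show "convex (T -` ball 0 e)"
        by (rule convex_linear_vimage [OF T convex_ball])
      show "- \<psi> \<in> T -` ball 0 e" if "\<psi> \<in> T -` ball 0 e" for \<psi>
        using that by (simp add: linear_neg [OF T])
      fix K :: "(real^'n) set"
      assume "compact K"
      then obtain N C where NC: "\<And>\<psi> e. supp (test_apply \<psi>) \<subseteq> K \<Longrightarrow>
          (\<forall>is x. length is \<le> N \<longrightarrow> \<bar>partials is (test_apply \<psi>) x\<bar> < e) \<Longrightarrow> norm (T \<psi>) \<le> C * e"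
        using bound by metis
      define d where "d = e / (\<bar>C\<bar> + 1)"
      have d: "d > 0" "C * d < e"
      proof -
        show "d > 0" using e by (simp add: d_def)
        have "C * d \<le> \<bar>C\<bar> * d" using \<open>d > 0\<close> by (simp add: mult_right_mono)
        also have "\<dots> < (\<bar>C\<bar> + 1) * d" using \<open>d > 0\<close> by simp
        also have "\<dots> = e" by (simp add: d_def)
        finally show "C * d < e" .
      qed
      show "\<exists>N. \<exists>\<epsilon>>0. \<forall>\<psi>. supp (test_apply \<psi>) \<subseteq> K \<and>
         (\<forall>is x. length is \<le> N \<longrightarrow> \<bar>partials is (test_apply \<psi>) x\<bar> < \<epsilon>) \<longrightarrow> \<psi> \<in> T -` ball 0 e"
        using NC d by (intro exI [of _ N] exI [of _ d]) force
    qed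
    moreover have "\<forall>\<psi>\<in>T -` ball 0 e. \<phi> + \<psi> \<in> T -` B"
      using e by (auto simp: linear_add [OF T] dist_norm subset_iff)
    ultimately show ?thesis by blast
  qed
  then show "open (T -` B \<inter> UNIV)"
    by (auto simp: open_test_fun_def)
qed

lemma continuous_linear_endo:
  fixes F :: "'n::finite test_fun \<Rightarrow> 'n test_fun"
  assumes F: "linear F" and S: "\<And>\<psi>. supp (test_apply (F \<psi>)) \<subseteq> supp (test_apply \<psi>)"
    and bound: "\<And>K N. compact K \<Longrightarrow> \<exists>N' C. \<forall>\<psi> e. supp (test_apply \<psi>) \<subseteq> K \<longrightarrow>
      (\<forall>is x. length is \<le> N' \<longrightarrow> \<bar>partials is (test_apply \<psi>) x\<bar> < e) \<longrightarrow>
      (\<forall>is x. length is \<le> N \<longrightarrow> \<bar>partials is (test_apply (F \<psi>)) x\<bar> \<le> C * e)"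
  shows "continuous_on UNIV F"
  unfolding continuous_on_open_vimage [OF open_UNIV]
proof (intro allI impI)
  fix B :: "'n test_fun set"
  assume B: "open B"
  have "\<exists>V. test_nbhd0 V \<and> (\<forall>\<psi>\<in>V. \<phi> + \<psi> \<in> F -` B)" if "F \<phi> \<in> B" for \<phi>
  proof -
    obtain V where V: "test_nbhd0 V" "\<forall>\<psi>\<in>V. F \<phi> + \<psi> \<in> B"
      using B \<open>F \<phi> \<in> B\<close> unfolding open_test_fun_def by blast
    have "test_nbhd0 (F -` V)"
      unfolding test_nbhd0_def
    proof (intro conjI allI impI ballI)
      show "convex (F -` V)"
        using V(1) by (intro convex_linear_vimage [OF F]) (simp add: test_nbhd0_def)
      show "- \<psi> \<in> F -` V" if "\<psi> \<in> F -` V" for \<psi>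
        using that V(1) by (simp add: linear_neg [OF F] test_nbhd0_def)
      fix K :: "(real^'n) set"
      assume K: "compact K"
      with V(1) obtain N e where e: "e > 0" and N: "\<And>\<psi>. supp (test_apply \<psi>) \<subseteq> K \<Longrightarrow>
          (\<And>is x. length is \<le> N \<Longrightarrow> \<bar>partials is (test_apply \<psi>) x\<bar> < e) \<Longrightarrow> \<psi> \<in> V"
        unfolding test_nbhd0_def by metis
      from bound [OF K, of N] obtain N' C where NC: "\<And>\<psi> e is x. supp (test_apply \<psi>) \<subseteq> K \<Longrightarrow>
          (\<forall>is x. length is \<le> N' \<longrightarrow> \<bar>partials is (test_apply \<psi>) x\<bar> < e) \<Longrightarrow>
          length is \<le> N \<Longrightarrow> \<bar>partials is (test_apply (F \<psi>)) x\<bar> \<le> C * e"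
        by metis
      define d where "d = e / (\<bar>C\<bar> + 1)"
      have d: "d > 0" "C * d < e"
      proof -
        show "d > 0" using e by (simp add: d_def)
        have "C * d \<le> \<bar>C\<bar> * d" using \<open>d > 0\<close> by (simp add: mult_right_mono)
        also have "\<dots> < (\<bar>C\<bar> + 1) * d" using \<open>d > 0\<close> by simp
        also have "\<dots> = e" by (simp add: d_def)
        finally show "C * d < e" .
      qed
      show "\<exists>N. \<exists>\<epsilon>>0. \<forall>\<psi>. supp (test_apply \<psi>) \<subseteq> K \<and>
         (\<forall>is x. length is \<le> N \<longrightarrow> \<bar>partials is (test_apply \<psi>) x\<bar> < \<epsilon>) \<longrightarrow> \<psi> \<in> F -` V"
      proof (intro exI conjI allI impI)
        show "d > 0" by (rule d)
        fix \<psi>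
        assume \<psi>: "supp (test_apply \<psi>) \<subseteq> K \<and>
          (\<forall>is x. length is \<le> N' \<longrightarrow> \<bar>partials is (test_apply \<psi>) x\<bar> < d)"
        have "F \<psi> \<in> V"
        proof (rule N)
          show "supp (test_apply (F \<psi>)) \<subseteq> K"
            using S [of \<psi>] \<psi> by blast
          fix "is" :: "'n list" and x
          assume "length is \<le> N"
          with \<psi> have "\<bar>partials is (test_apply (F \<psi>)) x\<bar> \<le> C * d"
            by (intro NC) auto
          with d show "\<bar>partials is (test_apply (F \<psi>)) x\<bar> < e"
            by linarith
        qed
        then show "\<psi> \<in> F -` V" by simp
      qed
    qed
    moreover have "\<forall>\<psi>\<in>F -` V. \<phi> + \<psi> \<in> F -` B"
      using V by (auto simp: linear_add [OF F])
    ultimately show ?thesis by blast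
  qed
  then show "open (F -` B \<inter> UNIV)"
    by (auto simp: open_test_fun_def)
qed

lemma continuous_test_partial: "continuous_on UNIV (test_partial i)"
proof (rule continuous_linear_endo [OF linear_test_partial])
  show "supp (test_apply (test_partial i \<psi>)) \<subseteq> supp (test_apply \<psi>)" for \<psi>
    by (simp add: test_partial.rep_eq supp_partial)
  show "\<exists>N' C. \<forall>\<psi> e. supp (test_apply \<psi>) \<subseteq> K \<longrightarrow>
      (\<forall>is x. length is \<le> N' \<longrightarrow> \<bar>partials is (test_apply \<psi>) x\<bar> < e) \<longrightarrow>
      (\<forall>is x. length is \<le> N \<longrightarrow> \<bar>partials is (test_apply (test_partial i \<psi>)) x\<bar> \<le> C * e)" for K N
  proof (rule exI [of _ "Suc N"], rule exI [of _ 1], intro allI impI)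
    fix \<psi> :: "'a test_fun" and e :: real and "is" :: "'a list" and x
    assume *: "\<forall>is x. length is \<le> Suc N \<longrightarrow> \<bar>partials is (test_apply \<psi>) x\<bar> < e" and "length is \<le> N"
    then have "\<bar>partials (is @ [i]) (test_apply \<psi>) x\<bar> < e"
      by (intro * [rule_format]) simp
    then show "\<bar>partials is (test_apply (test_partial i \<psi>)) x\<bar> \<le> 1 * e"
      by (simp add: test_partial.rep_eq)
  qed
qed

lemma partials_supp: "supp (partials is f) \<subseteq> supp f"
  by (induction "is") (use supp_partial in force)+

lemma continuous_test_coord_mult:
  fixes j :: "'n::finite"
  shows "continuous_on UNIV (test_coord_mult j)"
proof (rule continuous_linear_endo [OF linear_test_coord_mult])
  show "supp (test_apply (test_coord_mult j \<psi>)) \<subseteq> supp (test_apply \<psi>)" for \<psi>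
    by (simp add: test_coord_mult.rep_eq closure_mono Collect_mono)
  fix K :: "(real^'n) set" and N :: nat
  assume "compact K"
  then obtain R where R: "\<And>x. x \<in> K \<Longrightarrow> norm x \<le> R"
    using compact_imp_bounded [of K] unfolding bounded_iff by blast
  define Q where "Q = (\<lambda>is L. (\<forall>l\<in>set L. length l \<le> length is) \<and> (\<forall>f. smooth f \<longrightarrow>
    partials is (\<lambda>x. x $ j * f x) = (\<lambda>x. x $ j * partials is f x + (\<Sum>l\<leftarrow>L. partials l f x))))"
  define L where "L is = (SOME l. Q is l)" for "is"
  have "Q is (L is)" for "is"
    unfolding L_def by (rule someI_ex) (unfold Q_def, rule partials_coord_mult_ex)
  then have L: "\<And>is l. l \<in> set (L is) \<Longrightarrow> length l \<le> length is"
    "\<And>is f. smooth f \<Longrightarrow>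
      partials is (\<lambda>x. x $ j * f x) = (\<lambda>x. x $ j * partials is f x + (\<Sum>l\<leftarrow>L is. partials l f x))"
    unfolding Q_def by blast+
  define M where "M = Max ((\<lambda>is. real (length (L is))) ` {is. length is \<le> N})"
  have fin: "finite {is :: 'n list. length is \<le> N}"
    using finite_lists_length_le [of "UNIV :: 'n set" N] by simp
  have M: "real (length (L is)) \<le> M" if "length is \<le> N" for "is"
    unfolding M_def using that fin by (intro Max_ge) auto
  show "\<exists>N' C. \<forall>\<psi> e. supp (test_apply \<psi>) \<subseteq> K \<longrightarrow>
      (\<forall>is x. length is \<le> N' \<longrightarrow> \<bar>partials is (test_apply \<psi>) x\<bar> < e) \<longrightarrow>
      (\<forall>is x. length is \<le> N \<longrightarrow> \<bar>partials is (test_apply (test_coord_mult j \<psi>)) x\<bar> \<le> C * e)"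
  proof (rule exI [of _ N], rule exI [of _ "\<bar>R\<bar> + M"], intro allI impI)
    fix \<psi> :: "'n test_fun" and e :: real and "is" :: "'n list" and x
    assume supp: "supp (test_apply \<psi>) \<subseteq> K"
      and *: "\<forall>is x. length is \<le> N \<longrightarrow> \<bar>partials is (test_apply \<psi>) x\<bar> < e" and len: "length is \<le> N"
    let ?f = "test_apply \<psi>"
    have f: "smooth ?f" using test_apply [of \<psi>] by simp
    have e: "e > 0"
      using * [rule_format, of "[]" 0] by simp
    have 1: "\<bar>x $ j * partials is ?f x\<bar> \<le> \<bar>R\<bar> * e"
    proof (cases "x \<in> K")
      case True
      have "\<bar>x $ j\<bar> \<le> \<bar>R\<bar>"
        using R [OF True] component_le_norm_cart [of x j] by linarith
      then show ?thesis
        unfolding abs_mult using * len by (intro mult_mono) (auto intro: less_imp_le)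
    next
      case False
      then have "partials is ?f x = 0"
        using supp partials_supp [of "is" ?f] closure_subset [of "{x. partials is ?f x \<noteq> 0}"] by blast
      then show ?thesis using e by simp
    qed
    have "\<bar>\<Sum>l\<leftarrow>L is. partials l ?f x\<bar> \<le> (\<Sum>l\<leftarrow>L is. \<bar>partials l ?f x\<bar>)"
      by (rule order_trans [OF sum_list_abs]) (simp add: o_def)
    also have "\<dots> \<le> (\<Sum>l\<leftarrow>L is. e)"
    proof (rule sum_list_mono)
      fix l assume "l \<in> set (L is)"
      then have "length l \<le> N"
        using L(1) len order_trans by blast
      with * show "\<bar>partials l ?f x\<bar> \<le> e"
        by (simp add: less_imp_le)
    qed
    also have "\<dots> \<le> M * e"
      using M [OF len] e by (simp add: sum_list_triv mult_right_mono)
    finally have 2: "\<bar>\<Sum>l\<leftarrow>L is. partials l ?f x\<bar> \<le> M * e" .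
    have "partials is (test_apply (test_coord_mult j \<psi>)) x = x $ j * partials is ?f x + (\<Sum>l\<leftarrow>L is. partials l ?f x)"
      by (simp add: test_coord_mult.rep_eq L(2) [OF f])
    then show "\<bar>partials is (test_apply (test_coord_mult j \<psi>)) x\<bar> \<le> (\<bar>R\<bar> + M) * e"
      using 1 2 by (simp add: distrib_right)
  qed
qed

lifting_forget clifford.lifting
lifting_forget test_fun.lifting

typedef (overloaded) ('a::"{real_vector,topological_space}", 'b::real_normed_vector) cont_linear =
  "{T::'a \<Rightarrow> 'b. linear T \<and> continuous_on UNIV T}"
  morphisms pairing Cont_linear
  by (rule exI [of _ "\<lambda>_. 0"]) (simp add: linear_iff)

setup_lifting type_definition_cont_linear

lemma linear_pairing: "linear (pairing T)"
  and continuous_pairing: "continuous_on UNIV (pairing T)"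
  using pairing [of T] by auto

instantiation cont_linear :: ("{real_vector,topological_space}", real_normed_vector) real_vector
begin

lift_definition zero_cont_linear :: "('a, 'b) cont_linear" is "\<lambda>_. 0"
  by (simp add: linear_iff)
lift_definition plus_cont_linear :: "('a, 'b) cont_linear \<Rightarrow> ('a, 'b) cont_linear \<Rightarrow> ('a, 'b) cont_linear"
  is "\<lambda>S T \<phi>. S \<phi> + T \<phi>"
  by (auto simp: linear_compose_add intro: continuous_on_add)
lift_definition minus_cont_linear :: "('a, 'b) cont_linear \<Rightarrow> ('a, 'b) cont_linear \<Rightarrow> ('a, 'b) cont_linear"
  is "\<lambda>S T \<phi>. S \<phi> - T \<phi>"
  by (auto simp: linear_compose_sub intro: continuous_on_diff)
lift_definition uminus_cont_linear :: "('a, 'b) cont_linear \<Rightarrow> ('a, 'b) cont_linear"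
  is "\<lambda>T \<phi>. - T \<phi>"
  by (auto simp: linear_compose_neg intro: continuous_on_minus)
lift_definition scaleR_cont_linear :: "real \<Rightarrow> ('a, 'b) cont_linear \<Rightarrow> ('a, 'b) cont_linear"
  is "\<lambda>c T \<phi>. c *\<^sub>R T \<phi>"
  by (auto simp: linear_compose_scale_right intro: continuous_on_scaleR)

instance
  by standard (transfer; simp add: fun_eq_iff algebra_simps)+

end

type_synonym 'n distribution = "('n test_fun, 'n clifford) cont_linear"

lemma test_apply_0_continuous: "continuous_on UNIV (\<lambda>\<phi>::'n::finite test_fun. test_apply \<phi> 0)"
proof (rule continuous_linear_into_normed)
  show "linear (\<lambda>\<phi>::'n test_fun. test_apply \<phi> 0)"
    by (rule linearI) (simp_all add: plus_test_fun.rep_eq scaleR_test_fun.rep_eq)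
  show "\<exists>N C. \<forall>\<psi> e. supp (test_apply \<psi>) \<subseteq> K \<longrightarrow>
      (\<forall>is x. length is \<le> N \<longrightarrow> \<bar>partials is (test_apply \<psi>) x\<bar> < e) \<longrightarrow>
      norm (test_apply \<psi> 0) \<le> C * e" for K :: "(real^'n) set"
  proof (rule exI [of _ 0], rule exI [of _ 1], intro allI impI)
    fix \<psi> :: "'n test_fun" and e :: real
    assume "\<forall>is x. length is \<le> 0 \<longrightarrow> \<bar>partials is (test_apply \<psi>) x\<bar> < e"
    then have "\<bar>partials [] (test_apply \<psi>) 0\<bar> < e"
      by blast
    then show "norm (test_apply \<psi> 0) \<le> 1 * e"
      by simp
  qed
qed

lift_definition delta :: "'n::{finite,linorder} distribution" is "\<lambda>\<phi>. of_real (test_apply \<phi> 0)"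
proof
  show "linear (\<lambda>\<phi>::'n test_fun. of_real (test_apply \<phi> 0) :: 'n clifford)"
    by (rule linearI) (simp_all add: plus_test_fun.rep_eq scaleR_test_fun.rep_eq scaleR_conv_of_real)
  show "continuous_on UNIV (\<lambda>\<phi>::'n test_fun. of_real (test_apply \<phi> 0) :: 'n clifford)"
    by (intro continuous_on_of_real test_apply_0_continuous)
qed

lemma linear_continuous_gen_sum:
  fixes T :: "'n::{finite,linorder} test_fun \<Rightarrow> 'n clifford"
  assumes T: "linear T" "continuous_on UNIV T"
    and F: "\<And>j. linear (F j)" "\<And>j. continuous_on UNIV (F j)"
  shows "linear (\<lambda>\<phi>. \<Sum>j\<in>UNIV. gen j * T (F j \<phi>))"
    and "continuous_on UNIV (\<lambda>\<phi>. \<Sum>j\<in>UNIV. gen j * T (F j \<phi>))"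
proof -
  show "linear (\<lambda>\<phi>. \<Sum>j\<in>UNIV. gen j * T (F j \<phi>))"
    by (rule linearI)
      (simp_all add: linear_add [OF T(1)] linear_add [OF F(1)] linear_cmul [OF T(1)] linear_cmul [OF F(1)]
        distrib_left sum.distrib scaleR_sum_right)
  have "continuous_on UNIV (\<lambda>\<phi>. T (F j \<phi>))" for j
    by (rule continuous_on_compose2 [OF T(2) F(2)]) simp
  then show "continuous_on UNIV (\<lambda>\<phi>. \<Sum>j\<in>UNIV. gen j * T (F j \<phi>))"
    by (intro continuous_on_sum continuous_on_mult_left)
qed

lift_definition dirac :: "'n::{finite,linorder} distribution \<Rightarrow> 'n distribution"
  is "\<lambda>T \<phi>. - (\<Sum>j\<in>UNIV. gen j * T (test_partial j \<phi>))"
  by (auto intro!: linear_compose_neg continuous_on_minus linear_continuous_gen_sum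
      linear_test_partial continuous_test_partial)

lift_definition vec_mult :: "'n::{finite,linorder} distribution \<Rightarrow> 'n distribution"
  is "\<lambda>T \<phi>. \<Sum>j\<in>UNIV. gen j * T (test_coord_mult j \<phi>)"
  by (auto intro!: linear_continuous_gen_sum linear_test_coord_mult continuous_test_coord_mult)

definition clifford_vec :: "real^'n::{finite,linorder} \<Rightarrow> 'n clifford"
  where "clifford_vec x = (\<Sum>j\<in>UNIV. (x $ j) *\<^sub>R gen j)"

text \<open>
  At the origin, where \<open>\<omega>\<close> is undefined, the next definition returns \<open>0\<close>. This does not affect
  \<open>\<phi> \<leftrightarrow> \<omega>\<phi>\<close> being a bijection (lemmas \<open>inj_omega_test\<close>, \<open>surj_omega_test\<close>).
\<close>

definition omega :: "real^'n::{finite,linorder} \<Rightarrow> 'n clifford"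
  where "omega x = clifford_vec x /\<^sub>R norm x"

typedef ('n::"{finite,linorder}") omega_fun = "range (\<lambda>\<phi>::'n test_fun. \<lambda>x. test_apply \<phi> x *\<^sub>R omega x)"
  by blast

setup_lifting type_definition_omega_fun

lift_definition omega_test :: "'n::{finite,linorder} test_fun \<Rightarrow> 'n omega_fun"
  is "\<lambda>\<phi> x. test_apply \<phi> x *\<^sub>R omega x"
  by blast

lemma clifford_vec_square: "clifford_vec x * clifford_vec x = - of_real ((norm x)\<^sup>2)"
proof -
  have gg: "gen i * gen j + gen j * gen i = (if i = j then - 2 else 0 :: 'a clifford)" for i j
    using gen_anticommute [of i j] gen_square [of i] by auto
  define S where "S = (\<Sum>i\<in>UNIV. \<Sum>j\<in>UNIV. (x $ i * x $ j) *\<^sub>R (gen i * gen j))"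
  have S: "clifford_vec x * clifford_vec x = S"
    by (simp add: S_def clifford_vec_def sum_product mult.commute)
  have "S = (\<Sum>j\<in>UNIV. \<Sum>i\<in>UNIV. (x $ i * x $ j) *\<^sub>R (gen i * gen j))"
    unfolding S_def by (rule sum.swap)
  then have "S = (\<Sum>i\<in>UNIV. \<Sum>j\<in>UNIV. (x $ i * x $ j) *\<^sub>R (gen j * gen i))"
    by (simp only: mult.commute [of "x $ i" "x $ j" for i j])
  then have "S + S = (\<Sum>i\<in>UNIV. \<Sum>j\<in>UNIV. (x $ i * x $ j) *\<^sub>R (gen i * gen j + gen j * gen i))"
    by (simp add: S_def sum.distrib scaleR_add_right)
  also have "\<dots> = (\<Sum>i\<in>UNIV. \<Sum>j\<in>UNIV. if i = j then (x $ i * x $ i) *\<^sub>R (- 2) else 0)"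
    by (intro sum.cong refl) (simp add: gg)
  also have "\<dots> = (\<Sum>i\<in>UNIV. (x $ i * x $ i) *\<^sub>R (- 2))"
    by simp
  also have "\<dots> = (norm x)\<^sup>2 *\<^sub>R (- 2)"
    by (simp add: power2_norm_eq_inner inner_vec_def scaleR_sum_left sum_negf)
  also have "\<dots> = (- of_real ((norm x)\<^sup>2)) + (- of_real ((norm x)\<^sup>2))"
    by (simp add: scaleR_conv_of_real mult_2_right)
  finally have "2 *\<^sub>R S = 2 *\<^sub>R (- of_real ((norm x)\<^sup>2))"
    by (simp only: scaleR_2)
  then show ?thesis
    unfolding S by (simp only: scaleR_cancel_left) simp
qed

lemma omega_square:
  assumes "x \<noteq> 0"
  shows "omega x * omega x = -1"
proof -
  have "omega x * omega x = (inverse (norm x) * inverse (norm x)) *\<^sub>R (clifford_vec x * clifford_vec x)"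
    by (simp add: omega_def)
  also have "\<dots> = (inverse (norm x) * inverse (norm x)) *\<^sub>R (- ((norm x)\<^sup>2 *\<^sub>R 1))"
    by (simp only: clifford_vec_square of_real_def)
  also have "\<dots> = - ((inverse (norm x) * norm x)\<^sup>2 *\<^sub>R 1)"
    by (simp add: power2_eq_square mult_ac)
  also have "\<dots> = -1"
    using assms by simp
  finally show ?thesis .
qed

lemma inj_omega_test: "inj (omega_test :: 'n::{finite,linorder} test_fun \<Rightarrow> 'n omega_fun)"
proof (rule injI)
  fix \<phi> \<psi> :: "'n test_fun"
  assume "omega_test \<phi> = omega_test \<psi>"
  then have "test_apply \<phi> x *\<^sub>R omega x = test_apply \<psi> x *\<^sub>R omega x" for x
    by transfer (simp add: fun_eq_iff)
  moreover have "omega x \<noteq> 0" if "x \<noteq> 0" for x :: "(real, 'n) vec"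
    using omega_square [OF that] by auto
  ultimately have eq: "test_apply \<phi> x = test_apply \<psi> x" if "x \<noteq> 0" for x
    using that by (metis scaleR_cancel_right)
  have "isCont (test_apply \<phi>) 0" "isCont (test_apply \<psi>) 0"
    using test_apply [of \<phi>] test_apply [of \<psi>]
    by (auto intro!: differentiable_imp_continuous_within dest: smoothD [of _ "[]"])
  then have 1: "test_apply \<phi> \<midarrow>0\<rightarrow> test_apply \<phi> 0" and 2: "test_apply \<psi> \<midarrow>0\<rightarrow> test_apply \<psi> 0"
    by (simp_all add: isCont_def)
  from 2 have "test_apply \<phi> \<midarrow>0\<rightarrow> test_apply \<psi> 0"
    by (rule Lim_transform_eventually) (auto simp: eventually_at_filter eq)
  with 1 have "test_apply \<phi> 0 = test_apply \<psi> 0"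
    by (rule LIM_unique)
  with eq have "test_apply \<phi> = test_apply \<psi>"
    by (metis ext)
  then show "\<phi> = \<psi>"
    by (simp add: test_apply_inject)
qed

lemma surj_omega_test: "surj omega_test"
proof (unfold surj_def, intro allI)
  fix y :: "'a omega_fun"
  show "\<exists>\<phi>. y = omega_test \<phi>"
    by transfer auto
qed

lemma inv_omega_test [simp]: "inv omega_test (omega_test \<phi>) = \<phi>"
  by (simp add: inj_omega_test)

instantiation omega_fun :: ("{finite,linorder}") real_vector
begin

lift_definition zero_omega_fun :: "'a omega_fun" is "\<lambda>_. 0"
  by (rule range_eqI [of _ _ 0]) (simp add: zero_test_fun.rep_eq)
lift_definition plus_omega_fun :: "'a omega_fun \<Rightarrow> 'a omega_fun \<Rightarrow> 'a omega_fun"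
  is "\<lambda>f g x. f x + g x"
  by (elim rangeE, rule range_eqI [of _ _ "_ + _"]) (simp add: plus_test_fun.rep_eq scaleR_add_left)
lift_definition minus_omega_fun :: "'a omega_fun \<Rightarrow> 'a omega_fun \<Rightarrow> 'a omega_fun"
  is "\<lambda>f g x. f x - g x"
  by (elim rangeE, rule range_eqI [of _ _ "_ - _"]) (simp add: minus_test_fun.rep_eq scaleR_diff_left)
lift_definition uminus_omega_fun :: "'a omega_fun \<Rightarrow> 'a omega_fun" is "\<lambda>f x. - f x"
  by (elim rangeE, rule range_eqI [of _ _ "- _"]) (simp add: uminus_test_fun.rep_eq)
lift_definition scaleR_omega_fun :: "real \<Rightarrow> 'a omega_fun \<Rightarrow> 'a omega_fun" is "\<lambda>c f x. c *\<^sub>R f x"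
  by (elim rangeE, rule range_eqI [of _ _ "_ *\<^sub>R _"]) (simp add: scaleR_test_fun.rep_eq)

instance
  by standard (transfer; simp add: fun_eq_iff algebra_simps)+

end

instantiation omega_fun :: ("{finite,linorder}") topological_space
begin

definition open_omega_fun :: "'a omega_fun set \<Rightarrow> bool"
  where "open_omega_fun U \<longleftrightarrow> open (omega_test -` U)"

instance
  by standard (auto simp: open_omega_fun_def vimage_Union)

end

lemma linear_omega_test: "linear omega_test"
  by (rule linearI; transfer; simp add: fun_eq_iff plus_test_fun.rep_eq scaleR_test_fun.rep_eq scaleR_add_left)

lemma continuous_omega_test: "continuous_on UNIV omega_test"
  by (simp add: continuous_on_open_vimage open_omega_fun_def)

lemma linear_inv_omega_test: "linear (inv omega_test)"
proof (rule linearI)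
  show "inv omega_test (f + g) = inv omega_test f + inv omega_test g" for f g :: "'a omega_fun"
    using surj_omega_test by (metis inv_omega_test linear_add [OF linear_omega_test] surj_def)
  show "inv omega_test (c *\<^sub>R f) = c *\<^sub>R inv omega_test f" for c and f :: "'a omega_fun"
    using surj_omega_test by (metis inv_omega_test linear_cmul [OF linear_omega_test] surj_def)
qed

lemma continuous_inv_omega_test: "continuous_on UNIV (inv omega_test)"
  by (simp add: continuous_on_open_vimage open_omega_fun_def vimage_def)

type_synonym 'n signumdistribution = "('n omega_fun, 'n clifford) cont_linear"

lift_definition omega_mult :: "'n::{finite,linorder} distribution \<Rightarrow> 'n signumdistribution"
  is "\<lambda>T f. - T (inv omega_test f)"
proof
  fix T :: "'n test_fun \<Rightarrow> 'n clifford"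
  assume T: "linear T \<and> continuous_on UNIV T"
  show "linear (\<lambda>f. - T (inv omega_test f))"
    using linear_compose [OF linear_inv_omega_test, of T] T by (simp add: linear_compose_neg o_def)
  show "continuous_on UNIV (\<lambda>f. - T (inv omega_test f))"
    using T by (intro continuous_on_minus continuous_on_compose2 [OF _ continuous_inv_omega_test, of UNIV T]) auto
qed

lemma pairing_omega_mult: "pairing (omega_mult T) (omega_test \<phi>) = - pairing T \<phi>"
  by (simp add: omega_mult.rep_eq)

lemma bij_omega_mult: "bij (omega_mult :: 'n::{finite,linorder} distribution \<Rightarrow> 'n signumdistribution)"
proof (rule bijI)
  show "inj (omega_mult :: 'n distribution \<Rightarrow> 'n signumdistribution)"
    by (rule injI) (metis ext neg_equal_iff_equal pairing_inject pairing_omega_mult)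
  show "surj (omega_mult :: 'n distribution \<Rightarrow> 'n signumdistribution)"
    unfolding surj_def
  proof
    fix S :: "'n signumdistribution"
    define T where "T = Cont_linear (\<lambda>\<phi>. - pairing S (omega_test \<phi>))"
    have "linear (\<lambda>\<phi>. - pairing S (omega_test \<phi>))"
      using linear_compose [OF linear_omega_test linear_pairing [of S]] by (simp add: linear_compose_neg o_def)
    moreover have "continuous_on UNIV (\<lambda>\<phi>. - pairing S (omega_test \<phi>))"
      by (intro continuous_on_minus continuous_on_compose2 [OF continuous_pairing continuous_omega_test]) auto
    ultimately have T: "pairing T \<phi> = - pairing S (omega_test \<phi>)" for \<phi>
      by (simp add: T_def Cont_linear_inverse)
    have "pairing S f = pairing (omega_mult T) f" for f
    proof -
      obtain \<phi> where "f = omega_test \<phi>"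
        using surj_omega_test by (metis surjD)
      then show ?thesis
        by (simp add: pairing_omega_mult T)
    qed
    then show "\<exists>T. S = omega_mult T"
      by (metis ext pairing_inject)
  qed
qed

text \<open>
  The names below are read as follows:
  \<open>dr_even_delta k\<close> is \<open>\<partial>\<^sub>r\<^bsup>2k\<^esup>\<delta>\<close> and \<open>omega_dr_odd_delta k\<close> is \<open>(\<omega>\<partial>\<^sub>r\<^bsup>2k+1\<^esup>)\<delta>\<close> (distributions);
  \<open>omega_dr_even_delta k\<close> is \<open>(\<omega>\<partial>\<^sub>r\<^bsup>2k\<^esup>)\<delta>\<close> and \<open>dr_odd_delta k\<close> is \<open>\<partial>\<^sub>r\<^bsup>2k+1\<^esup>\<delta>\<close> (signumdistributions).
\<close>

definition radial_coeff :: "nat \<Rightarrow> nat \<Rightarrow> real"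
  where "radial_coeff m k = (-1) ^ k / (2 ^ k * fact k) * (\<Prod>j<k. real m + 2 * real j + 1)"

definition dr_even_delta :: "nat \<Rightarrow> 'n::{finite,linorder} distribution"
  where "dr_even_delta k = radial_coeff CARD('n) k *\<^sub>R (dirac ^^ (2 * k)) delta"

definition omega_dr_odd_delta :: "nat \<Rightarrow> 'n::{finite,linorder} distribution"
  where "omega_dr_odd_delta k = radial_coeff CARD('n) k *\<^sub>R (dirac ^^ (2 * k + 1)) delta"

definition omega_dr_even_delta :: "nat \<Rightarrow> 'n::{finite,linorder} signumdistribution"
  where "omega_dr_even_delta k = omega_mult (dr_even_delta k)"

definition dr_odd_delta :: "nat \<Rightarrow> 'n::{finite,linorder} signumdistribution"
  where "dr_odd_delta k = - omega_mult (omega_dr_odd_delta k)"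

text \<open>
  The operators \<open>\<omega>\<partial>\<^sub>r\<close> and \<open>1/x\<close> are prescribed on the derivatives of \<open>\<delta>\<close> and extended by
  linearity to their real span; outside this span \<open>omega_dr\<close>, \<open>inv_vec\<close>, and with them \<open>inv_r\<close>
  and \<open>dr\<close>, have no meaning.
\<close>

definition omega_dr :: "'n::{finite,linorder} distribution \<Rightarrow> 'n distribution"
  where "omega_dr = (SOME L. linear L \<and>
    (\<forall>k. L (dr_even_delta k) = omega_dr_odd_delta k) \<and>
    (\<forall>k. L (omega_dr_odd_delta k) = - dr_even_delta (k + 1)))"

definition inv_vec :: "real \<Rightarrow> 'n::{finite,linorder} distribution \<Rightarrow> 'n distribution"
  where "inv_vec c\<^sub>0 = (SOME L. linear L \<and>
    (\<forall>k. L ((dirac ^^ (2 * k)) delta) = (1 / (real CARD('n) + 2 * real k)) *\<^sub>R (dirac ^^ (2 * k + 1)) delta) \<and>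
    (\<forall>k. L ((dirac ^^ (2 * k + 1)) delta) =
      (1 / (2 * real k + 2)) *\<^sub>R (dirac ^^ (2 * k + 2)) delta + c\<^sub>0 *\<^sub>R delta))"

text \<open>
  By \<open>pairing_omega_mult\<close>, this is \<open>\<langle>(1/r)T, \<omega>\<phi>\<rangle> = -\<langle>(1/x)T, \<phi>\<rangle>\<close>.
\<close>

definition inv_r :: "real \<Rightarrow> 'n::{finite,linorder} distribution \<Rightarrow> 'n signumdistribution"
  where "inv_r c\<^sub>0 T = omega_mult (inv_vec c\<^sub>0 T)"

text \<open>
  By \<open>bij_omega_mult\<close>, \<open>inv omega_mult S\<close> is the unique \<open>T\<close> with \<open>S = \<omega>T\<close>.
\<close>

definition r_mult :: "'n::{finite,linorder} signumdistribution \<Rightarrow> 'n distribution"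
  where "r_mult S = vec_mult (inv omega_mult S)"

definition dr :: "'n::{finite,linorder} signumdistribution \<Rightarrow> 'n distribution"
  where "dr S = omega_dr (inv omega_mult S)"

end

theory Submission
  imports Defs
begin

text \<open>
  Write \<open>x\<close> for left multiplication by the vector variable and \<open>\<partial>\<close> for the Dirac operator. The
  operator \<open>\<partial>\<^sup>2\<close> is minus the Laplacian, so moving \<open>x\<close> past it needs no commutation of Clifford
  generators and leaves only a first-order term, \<open>x \<partial>\<^sup>2 = \<partial>\<^sup>2 x + 2 \<partial>\<close> (\<open>vec_mult_dirac_dirac\<close>).
  From \<open>x \<delta> = 0\<close> and \<open>x \<partial>\<delta> = m \<delta>\<close> it follows in steps of two that \<open>x\<close> maps each \<open>\<partial>\<^bsup>n+1\<^esup>\<delta>\<close> to a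
  positive multiple of \<open>\<partial>\<^bsup>n\<^esup>\<delta>\<close>, namely \<open>m + n\<close> times it for even \<open>n\<close> and \<open>n + 1\<close> times it for odd \<open>n\<close>
  (\<open>vec_mult_dirac_power_delta\<close>). The first four identities then compare coefficients, since \<open>r\<close>
  acts on \<open>\<omega>T\<close> as \<open>x\<close> acts on \<open>T\<close>; the constant \<open>c\<^sub>0\<close> disappears because \<open>x \<delta> = 0\<close>.

  The last two identities restate how \<open>\<omega>\<partial>\<^sub>r\<close> is prescribed. As \<open>\<omega>\<partial>\<^sub>r\<close> and \<open>1/x\<close> are given by a choice
  among the linear maps with prescribed values on multiples of the \<open>\<partial>\<^bsup>n\<^esup>\<delta>\<close>, it has to be shown that
  such maps exist. This follows again from the action of \<open>x\<close>: a lowering operator with nonzero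
  coefficients forces the \<open>\<partial>\<^bsup>n\<^esup>\<delta>\<close> to be linearly independent (\<open>linear_prescribed_on_iterates\<close>).
\<close>

section \<open>Symmetry of mixed partial derivatives\<close>

lemma has_field_derivative_along_axis:
  fixes f :: "real^'n::finite \<Rightarrow> real"
  assumes "f differentiable (at (y + s *\<^sub>R axis i 1))"
  shows "((\<lambda>s. f (y + s *\<^sub>R axis i 1)) has_field_derivative partial i f (y + s *\<^sub>R axis i 1)) (at s)"
proof -
  let ?F = "frechet_derivative f (at (y + s *\<^sub>R axis i 1))"
  have F: "(f has_derivative ?F) (at (y + s *\<^sub>R axis i 1))"
    using assms by (simp add: frechet_derivative_works)
  have "((\<lambda>s. y + s *\<^sub>R axis i 1) has_derivative (\<lambda>t. t *\<^sub>R axis i 1)) (at s)"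
    by (auto intro!: derivative_eq_intros)
  from has_derivative_compose [OF this F]
  have "((\<lambda>s. f (y + s *\<^sub>R axis i 1)) has_derivative (\<lambda>t. ?F (t *\<^sub>R axis i 1))) (at s)" .
  moreover have "?F (t *\<^sub>R axis i 1) = partial i f (y + s *\<^sub>R axis i 1) * t" for t
    using linear_cmul [OF has_derivative_linear [OF F]] by (simp add: partial_def)
  ultimately show ?thesis
    by (simp add: has_field_derivative_def)
qed

text \<open>
  Two applications of the mean value theorem, first in direction \<open>i\<close> and then in direction \<open>j\<close>. The
  left-hand side is symmetric in \<open>i\<close> and \<open>j\<close>; this is what makes mixed derivatives agree.
\<close>

lemma second_difference_mean_value:
  fixes f :: "real^'n::finite \<Rightarrow> real"
  assumes f: "smooth f" and h: "h > 0"
  obtains p where "dist p x < 2 * h"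
    "f (x + h *\<^sub>R axis i 1 + h *\<^sub>R axis j 1) - f (x + h *\<^sub>R axis i 1) - f (x + h *\<^sub>R axis j 1) + f x
      = h * h * partial j (partial i f) p"
proof -
  let ?i = "axis i 1 :: real^'n" and ?j = "axis j 1 :: real^'n"
  note d = has_field_derivative_along_axis
  have d1: "f differentiable (at y)" "partial i f differentiable (at y)" for y
    using smoothD [OF f, of "[]"] smoothD [OF f, of "[i]"] by simp_all
  have "\<exists>s. 0 < s \<and> s < h \<and>
      (f (x + h *\<^sub>R ?j + h *\<^sub>R ?i) - f (x + h *\<^sub>R ?i)) - (f (x + h *\<^sub>R ?j + 0 *\<^sub>R ?i) - f (x + 0 *\<^sub>R ?i))
      = (h - 0) * (partial i f (x + h *\<^sub>R ?j + s *\<^sub>R ?i) - partial i f (x + s *\<^sub>R ?i))"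
    by (rule MVT2 [OF h]) (intro DERIV_diff d d1)
  then obtain s where s: "0 < s" "s < h"
    and *: "f (x + h *\<^sub>R ?j + h *\<^sub>R ?i) - f (x + h *\<^sub>R ?i) - f (x + h *\<^sub>R ?j) + f x
      = h * (partial i f (x + h *\<^sub>R ?j + s *\<^sub>R ?i) - partial i f (x + s *\<^sub>R ?i))"
    by (auto simp: algebra_simps)
  have "\<exists>t. 0 < t \<and> t < h \<and>
      partial i f (x + s *\<^sub>R ?i + h *\<^sub>R ?j) - partial i f (x + s *\<^sub>R ?i + 0 *\<^sub>R ?j)
      = (h - 0) * partial j (partial i f) (x + s *\<^sub>R ?i + t *\<^sub>R ?j)"
    by (rule MVT2 [OF h]) (intro d d1)
  then obtain t where t: "0 < t" "t < h"
    and **: "partial i f (x + s *\<^sub>R ?i + h *\<^sub>R ?j) - partial i f (x + s *\<^sub>R ?i)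
      = h * partial j (partial i f) (x + s *\<^sub>R ?i + t *\<^sub>R ?j)"
    by auto
  show thesis
  proof
    have "norm (s *\<^sub>R ?i + t *\<^sub>R ?j) \<le> s + t"
      using norm_triangle_ineq [of "s *\<^sub>R ?i" "t *\<^sub>R ?j"] s t by simp
    then show "dist (x + s *\<^sub>R ?i + t *\<^sub>R ?j) x < 2 * h"
      using s t by (simp add: dist_norm add.assoc)
    show "f (x + h *\<^sub>R ?i + h *\<^sub>R ?j) - f (x + h *\<^sub>R ?i) - f (x + h *\<^sub>R ?j) + f x
      = h * h * partial j (partial i f) (x + s *\<^sub>R ?i + t *\<^sub>R ?j)"
      using * ** by (simp add: add_ac)
  qed
qed

lemma partial_commute:
  fixes f :: "real^'n::finite \<Rightarrow> real"
  assumes f: "smooth f"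
  shows "partial i (partial j f) = partial j (partial i f)"
proof (rule ext, rule ccontr)
  fix x
  let ?a = "partial j (partial i f)" and ?b = "partial i (partial j f)"
  assume "?b x \<noteq> ?a x"
  define e where "e = \<bar>?a x - ?b x\<bar> / 2"
  have e: "e > 0"
    using \<open>?b x \<noteq> ?a x\<close> by (simp add: e_def)
  have "isCont ?a x" "isCont ?b x"
    using smoothD [OF f, of "[j, i]" x] smoothD [OF f, of "[i, j]" x]
    by (auto intro: differentiable_imp_continuous_within)
  with e obtain d d' where d: "d > 0" "\<And>p. dist p x < d \<Longrightarrow> \<bar>?a p - ?a x\<bar> < e"
    and d': "d' > 0" "\<And>p. dist p x < d' \<Longrightarrow> \<bar>?b p - ?b x\<bar> < e"
    unfolding continuous_at_eps_delta dist_real_def by metis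
  define h where "h = min d d' / 2"
  have h: "h > 0" "2 * h \<le> d" "2 * h \<le> d'"
    using d d' by (auto simp: h_def)
  obtain p where p: "dist p x < 2 * h"
    "f (x + h *\<^sub>R axis i 1 + h *\<^sub>R axis j 1) - f (x + h *\<^sub>R axis i 1) - f (x + h *\<^sub>R axis j 1) + f x
      = h * h * ?a p"
    using second_difference_mean_value [OF f h(1)] .
  obtain q where q: "dist q x < 2 * h"
    "f (x + h *\<^sub>R axis j 1 + h *\<^sub>R axis i 1) - f (x + h *\<^sub>R axis j 1) - f (x + h *\<^sub>R axis i 1) + f x
      = h * h * ?b q"
    using second_difference_mean_value [OF f h(1)] .
  have "x + h *\<^sub>R axis i 1 + h *\<^sub>R axis j 1 = x + h *\<^sub>R axis j 1 + h *\<^sub>R axis i 1"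
    by (simp add: add_ac)
  with p(2) q(2) have "h * h * ?a p = h * h * ?b q"
    by (smt (verit))
  then have "?a p = ?b q"
    using h(1) by simp
  moreover have "\<bar>?a p - ?a x\<bar> < e" "\<bar>?b q - ?b x\<bar> < e"
    using d(2) [of p] d'(2) [of q] p(1) q(1) h by auto
  ultimately show False
    by (simp add: e_def abs_if split: if_splits)
qed

section \<open>The Dirac operator and multiplication by the vector variable\<close>

lemma smooth_test_apply: "smooth (test_apply \<phi>)"
  using test_apply [of \<phi>] by simp

lemma test_partial_commute: "test_partial i (test_partial j \<phi>) = test_partial j (test_partial i \<phi>)"
  by (simp add: test_apply_inject [symmetric] test_partial.rep_eq partial_commute smooth_test_apply)

lemma test_partial_coord_mult:
  "test_partial i (test_coord_mult j \<phi>)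
    = test_coord_mult j (test_partial i \<phi>) + (if i = j then \<phi> else 0)"
proof -
  have "partial i (\<lambda>x. x $ j * test_apply \<phi> x) x
      = x $ j * partial i (test_apply \<phi>) x + (if i = j then test_apply \<phi> x else 0)" for x
    using smoothD [OF smooth_test_apply, of "[]" \<phi> x]
    by (simp add: partial_mult differentiable_coord partial_coord)
  then show ?thesis
    by (simp add: test_apply_inject [symmetric] test_partial.rep_eq test_coord_mult.rep_eq
        plus_test_fun.rep_eq zero_test_fun.rep_eq fun_eq_iff)
qed

lemma linear_dirac: "linear dirac"
  by (rule linearI; transfer)
    (simp_all add: fun_eq_iff distrib_left sum.distrib scaleR_sum_right)

lemma linear_vec_mult: "linear vec_mult"
  by (rule linearI; transfer)
    (simp_all add: fun_eq_iff distrib_left sum.distrib scaleR_sum_right)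

lemma gen_anticommutator: "gen i * gen j + gen j * gen i = (if i = j then - 2 else 0)"
  using gen_anticommute [of i j] gen_square [of i] by auto

text \<open>
  The square of the Dirac operator is minus the Laplacian: mixed derivatives commute, so in the
  double sum only the anticommutators of the generators survive.
\<close>

lemma pairing_dirac_dirac:
  "pairing (dirac (dirac T)) \<phi> = - (\<Sum>j\<in>UNIV. pairing T (test_partial j (test_partial j \<phi>)))"
proof -
  let ?t = "\<lambda>i j. pairing T (test_partial i (test_partial j \<phi>))"
  define S where "S = (\<Sum>j\<in>UNIV. \<Sum>i\<in>UNIV. gen j * gen i * ?t i j)"
  have S: "pairing (dirac (dirac T)) \<phi> = S"
    by (simp add: S_def dirac.rep_eq sum_negf sum_distrib_left mult.assoc)
  have "S = (\<Sum>j\<in>UNIV. \<Sum>i\<in>UNIV. gen i * gen j * ?t i j)"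
    unfolding S_def by (subst sum.swap) (simp add: test_partial_commute)
  then have "S + S = (\<Sum>j\<in>UNIV. \<Sum>i\<in>UNIV. (gen j * gen i + gen i * gen j) * ?t i j)"
    by (simp add: S_def sum.distrib distrib_right)
  also have "\<dots> = (\<Sum>j\<in>UNIV. \<Sum>i\<in>UNIV. if j = i then - 2 * ?t j j else 0)"
    by (intro sum.cong refl) (simp add: gen_anticommutator)
  also have "\<dots> = (\<Sum>j\<in>UNIV. - 2 * ?t j j)"
    by simp
  also have "\<dots> = 2 *\<^sub>R - (\<Sum>j\<in>UNIV. ?t j j)"
    by (simp add: sum_negf scaleR_sum_right scaleR_2 mult_2 sum.distrib sum_subtractf)
  finally have "2 *\<^sub>R S = 2 *\<^sub>R - (\<Sum>j\<in>UNIV. ?t j j)"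
    by (simp only: scaleR_2)
  then show ?thesis
    unfolding S by (simp only: scaleR_cancel_left) simp
qed

text \<open>
  The first-order term comes from the Laplacian of a product,
  \<open>\<Delta>(x\<^sub>k \<phi>) = x\<^sub>k \<Delta>\<phi> + 2 \<partial>\<^sub>k \<phi>\<close>; the factors \<open>2 \<partial>\<^sub>k\<close> assemble to the Dirac operator.
\<close>

lemma vec_mult_dirac_dirac:
  "vec_mult (dirac (dirac T)) = dirac (dirac (vec_mult T)) + 2 *\<^sub>R dirac T"
proof -
  note lin = linear_add [OF linear_pairing] linear_add [OF linear_test_partial] linear_0 [OF linear_test_partial]
    linear_0 [OF linear_pairing]
  have 1: "(\<Sum>j\<in>UNIV. pairing T (test_partial j (test_partial j (test_coord_mult k \<phi>))))
      = (\<Sum>j\<in>UNIV. pairing T (test_coord_mult k (test_partial j (test_partial j \<phi>))))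
        + 2 *\<^sub>R pairing T (test_partial k \<phi>)" for k \<phi>
  proof -
    have "test_partial j (test_partial j (test_coord_mult k \<phi>))
        = test_coord_mult k (test_partial j (test_partial j \<phi>))
          + (if j = k then 2 *\<^sub>R test_partial j \<phi> else 0)" for j
      by (simp add: test_partial_coord_mult lin scaleR_2)
    then have "(\<Sum>j\<in>UNIV. pairing T (test_partial j (test_partial j (test_coord_mult k \<phi>))))
      = (\<Sum>j\<in>UNIV. pairing T (test_coord_mult k (test_partial j (test_partial j \<phi>)))
         + (if j = k then 2 *\<^sub>R pairing T (test_partial j \<phi>) else 0))"
      by (intro sum.cong refl) (simp add: lin linear_cmul [OF linear_pairing])
    then show ?thesis
      by (simp add: sum.distrib)
  qed
  have "pairing (vec_mult (dirac (dirac T))) \<phi>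
      = pairing (dirac (dirac (vec_mult T)) + 2 *\<^sub>R dirac T) \<phi>" for \<phi>
  proof -
    have "pairing (vec_mult (dirac (dirac T))) \<phi>
      = - (\<Sum>k\<in>UNIV. \<Sum>j\<in>UNIV. gen k * pairing T (test_coord_mult k (test_partial j (test_partial j \<phi>))))
        - (\<Sum>k\<in>UNIV. gen k * 2 *\<^sub>R pairing T (test_partial k \<phi>))"
      by (simp add: vec_mult.rep_eq pairing_dirac_dirac 1 sum_negf sum_subtractf sum.distrib distrib_left
          right_diff_distrib sum_distrib_left)
    also have "(\<Sum>k\<in>UNIV. \<Sum>j\<in>UNIV. gen k * pairing T (test_coord_mult k (test_partial j (test_partial j \<phi>))))
      = - pairing (dirac (dirac (vec_mult T))) \<phi>"
      by (subst sum.swap) (simp add: vec_mult.rep_eq pairing_dirac_dirac)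
    also have "(\<Sum>k\<in>UNIV. gen k * 2 *\<^sub>R pairing T (test_partial k \<phi>)) = - 2 *\<^sub>R pairing (dirac T) \<phi>"
      by (simp add: dirac.rep_eq scaleR_sum_right sum_negf)
    finally show ?thesis
      by (simp add: plus_cont_linear.rep_eq scaleR_cont_linear.rep_eq)
  qed
  then show ?thesis
    by (simp add: pairing_inject [symmetric] fun_eq_iff)
qed

section \<open>Powers of the Dirac operator applied to the delta distribution\<close>

lemma vec_mult_delta: "vec_mult delta = 0"
  by (simp add: pairing_inject [symmetric] fun_eq_iff vec_mult.rep_eq delta.rep_eq
      test_coord_mult.rep_eq zero_cont_linear.rep_eq)

lemma vec_mult_dirac_delta:
  "vec_mult (dirac delta) = real CARD('n) *\<^sub>R (delta :: 'n::{finite,linorder} distribution)"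
proof -
  have "pairing (vec_mult (dirac delta)) \<phi> = pairing (real CARD('n) *\<^sub>R delta) \<phi>" for \<phi> :: "'n test_fun"
  proof -
    have d: "pairing delta (test_partial i (test_coord_mult j \<phi>))
        = (if i = j then pairing delta \<phi> else 0)" for i j
      by (simp add: test_partial_coord_mult delta.rep_eq plus_test_fun.rep_eq zero_test_fun.rep_eq
          test_coord_mult.rep_eq)
    have "pairing (vec_mult (dirac delta)) \<phi>
      = (\<Sum>j\<in>UNIV. gen j * - (\<Sum>i\<in>UNIV. gen i * (if i = j then pairing delta \<phi> else 0)))"
      by (simp add: vec_mult.rep_eq dirac.rep_eq d)
    also have "\<dots> = (\<Sum>j\<in>(UNIV::'n set). - (gen j * gen j) * pairing delta \<phi>)"
      by (intro sum.cong refl) (simp add: if_distrib mult.assoc cong: if_cong)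
    also have "\<dots> = pairing (real CARD('n) *\<^sub>R delta) \<phi>"
      by (simp add: gen_square scaleR_cont_linear.rep_eq scaleR_conv_of_real)
    finally show ?thesis .
  qed
  then show ?thesis
    by (simp add: pairing_inject [symmetric] fun_eq_iff)
qed

definition lowering_coeff :: "nat \<Rightarrow> nat \<Rightarrow> real"
  where "lowering_coeff m n = (if even n then real m + real n else real n + 1)"

lemma lowering_coeff_pos: "m > 0 \<Longrightarrow> lowering_coeff m n > 0"
  by (simp add: lowering_coeff_def add_pos_nonneg)

text \<open>
  The recursion in \<open>n\<close> has step two, which is why the coefficients depend on the parity of \<open>n\<close>: the two
  chains start from \<open>x \<partial>\<delta> = m \<delta>\<close> and \<open>x \<partial>\<^sup>2\<delta> = 2 \<partial>\<delta>\<close>, and each step adds \<open>2\<close>.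
\<close>

lemma vec_mult_dirac_power_delta:
  "vec_mult ((dirac ^^ Suc n) delta)
    = lowering_coeff CARD('n) n *\<^sub>R (dirac ^^ n) (delta :: 'n::{finite,linorder} distribution)"
proof (induction n rule: induct_nat_012)
  case 0
  show ?case by (simp add: vec_mult_dirac_delta lowering_coeff_def)
next
  case 1
  show ?case
    by (simp add: vec_mult_dirac_dirac vec_mult_delta linear_0 [OF linear_dirac] lowering_coeff_def)
next
  case (ge2 n)
  have "vec_mult ((dirac ^^ Suc (Suc (Suc n))) (delta :: 'n distribution))
    = dirac (dirac (vec_mult ((dirac ^^ Suc n) delta))) + 2 *\<^sub>R (dirac ^^ Suc (Suc n)) delta"
    by (simp add: vec_mult_dirac_dirac)
  also have "\<dots> = (lowering_coeff CARD('n) n + 2) *\<^sub>R (dirac ^^ Suc (Suc n)) delta"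
    unfolding ge2(1) linear_cmul [OF linear_dirac] by (simp add: scaleR_add_left)
  also have "lowering_coeff CARD('n) n + 2 = lowering_coeff CARD('n) (Suc (Suc n))"
    by (simp add: lowering_coeff_def)
  finally show ?case .
qed

section \<open>Linear maps prescribed on the iterates of a raising operator\<close>

lemma linear_funpow:
  fixes A :: "'a::real_vector \<Rightarrow> 'a"
  assumes "linear A"
  shows "linear (A ^^ n)"
proof (induction n)
  case 0
  show ?case using linear_id by (simp add: id_def)
next
  case (Suc n)
  then show ?case using linear_compose [OF Suc assms] by (simp add: o_def)
qed

text \<open>
  If \<open>d \<noteq> 0\<close>, the power \<open>A\<^sup>n\<close> annihilates all earlier iterates \<open>D\<^sup>k d\<close> but not \<open>D\<^sup>n d\<close>, so the iterates are
  linearly independent and values can be prescribed freely. Values in the span of the iterates are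
  also attainable for \<open>d = 0\<close>, because then the iterates and hence the values all vanish.
\<close>

lemma linear_prescribed_on_iterates:
  fixes D A :: "'a::real_vector \<Rightarrow> 'a" and E :: "nat \<Rightarrow> 'a"
  assumes D: "linear D" and A: "linear A" and d: "A d = 0"
    and lower: "\<And>n. A ((D ^^ Suc n) d) = c n *\<^sub>R (D ^^ n) d"
    and c: "\<And>n. c n \<noteq> 0"
    and E: "\<And>n. E n \<in> span (range (\<lambda>n. (D ^^ n) d))"
  shows "\<exists>L. linear L \<and> (\<forall>n. L ((D ^^ n) d) = E n)"
proof (cases "d = 0")
  case True
  then have "(D ^^ n) d = 0" for n
    using linear_0 [OF linear_funpow [OF D]] by simp
  moreover from this E have "E n = 0" for n
    by simp
  ultimately show ?thesis
    by (intro exI [of _ "\<lambda>_. 0"]) (simp add: linear_iff)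
next
  case False
  define v where "v n = (D ^^ n) d" for n
  have low: "A (v (Suc n)) = c n *\<^sub>R v n" "A (v 0) = 0" for n
    using lower d by (simp_all add: v_def)
  have lin: "linear (A ^^ n)" for n
    by (rule linear_funpow [OF A])
  have kill: "(A ^^ n) (v k) = 0" if "k < n" for n k
    using that
  proof (induction n arbitrary: k)
    case (Suc n)
    then show ?case
      by (cases k) (simp_all add: low funpow_Suc_right linear_0 [OF lin] linear_cmul [OF lin] del: funpow.simps)
  qed simp
  have keep: "(A ^^ n) (v n) = (\<Prod>k<n. c k) *\<^sub>R d" for n
  proof (induction n)
    case 0
    show ?case by (simp add: v_def)
  next
    case (Suc n)
    then show ?case
      by (simp add: low funpow_Suc_right linear_cmul [OF lin] mult.commute del: funpow.simps)
  qed
  have new: "v n \<notin> span (v ` {..<n})" for n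
  proof
    assume "v n \<in> span (v ` {..<n})"
    then have "(A ^^ n) (v n) = 0"
      by (rule linear_eq_0_on_span [OF lin, rotated]) (auto simp: kill)
    with keep False c show False
      by simp
  qed
  have "independent (v ` {..<n})" for n
  proof (induction n)
    case (Suc n)
    then show ?case
      using independent_insertI [OF new] by (simp add: lessThan_Suc)
  qed (simp add: dependent_def)
  then have "independent (\<Union>n. v ` {..<n})"
  proof (intro independent_Union_directed)
    fix B C assume "B \<in> range (\<lambda>n. v ` {..<n})" "C \<in> range (\<lambda>n. v ` {..<n})"
    then obtain m n where "B = v ` {..<m}" "C = v ` {..<n}" by blast
    then show "B \<subseteq> C \<or> C \<subseteq> B"
      by (metis image_mono lessThan_subset_iff nat_le_linear)
  qed auto
  moreover have "(\<Union>n. v ` {..<n}) = range v"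
    by (auto intro: lessI)
  ultimately have "independent (range v)"
    by simp
  then obtain L where L: "linear L" "\<And>x. x \<in> range v \<Longrightarrow> L x = E (inv v x)"
    using linear_independent_extend [of "range v" "\<lambda>x. E (inv v x)"] by blast
  have "inj v"
  proof (rule linorder_injI)
    fix m n :: nat assume "m < n"
    then show "v m \<noteq> v n"
      using new [of n] span_base [of "v m" "v ` {..<n}"] by auto
  qed
  then show ?thesis
    using L by (auto simp: v_def [symmetric])
qed

section \<open>Existence of the prescribed operators\<close>

lemma linear_prescribed_on_dirac_powers:
  fixes E :: "nat \<Rightarrow> 'n::{finite,linorder} distribution"
  assumes "\<And>n. E n \<in> span (range (\<lambda>n. (dirac ^^ n) delta))"
  shows "\<exists>L. linear L \<and> (\<forall>n. L ((dirac ^^ n) (delta :: 'n distribution)) = E n)"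
proof (rule linear_prescribed_on_iterates [OF linear_dirac linear_vec_mult vec_mult_delta
      vec_mult_dirac_power_delta _ assms])
  show "lowering_coeff CARD('n) n \<noteq> 0" for n
    using lowering_coeff_pos [OF zero_less_card_finite [where 'a='n]] by (metis less_irrefl)
qed

lemma radial_coeff_nonzero: "radial_coeff m k \<noteq> 0"
  by (auto simp: radial_coeff_def)

lemma radial_coeff_Suc:
  "(2 * real k + 2) * radial_coeff m (Suc k) = - (real m + 2 * real k + 1) * radial_coeff m k"
proof -
  have "(2 * real k + 2) / (2 ^ Suc k * fact (Suc k)) = 1 / (2 ^ k * fact k :: real)"
    by (simp add: divide_simps)
  moreover have "(2 * real k + 2) * radial_coeff m (Suc k)
      = - (real m + 2 * real k + 1) * (-1) ^ k * (\<Prod>j<k. real m + 2 * real j + 1)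
        * ((2 * real k + 2) / (2 ^ Suc k * fact (Suc k)))"
    by (simp add: radial_coeff_def algebra_simps power_Suc [of "- 1 :: real"] diff_divide_distrib
        add_divide_distrib del: fact_Suc power_Suc)
  ultimately show ?thesis
    by (simp add: radial_coeff_def)
qed

lemma omega_dr_prescribed:
  "linear (omega_dr :: 'n::{finite,linorder} distribution \<Rightarrow> 'n distribution)"
  "omega_dr (dr_even_delta k) = (omega_dr_odd_delta k :: 'n distribution)"
  "omega_dr (omega_dr_odd_delta k) = - (dr_even_delta (k + 1) :: 'n distribution)"
proof -
  let ?a = "radial_coeff CARD('n)" and ?v = "\<lambda>n. (dirac ^^ n) delta :: 'n distribution"
  \<comment> \<open>The quotient turns the prescribed value at a multiple of \<open>\<partial>\<^bsup>2k+1\<^esup>\<delta>\<close> into the value at \<open>\<partial>\<^bsup>2k+1\<^esup>\<delta>\<close> itself.\<close>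
  define E where "E n = (if even n then ?v (n + 1)
    else - (?a (n div 2 + 1) / ?a (n div 2)) *\<^sub>R ?v (n + 1))" for n
  have v: "?v n \<in> span (range ?v)" for n
    by (rule span_base) simp
  have "E n \<in> span (range ?v)" for n
    using v [of "n + 1"] by (simp add: E_def span_scale span_neg del: funpow.simps)
  then obtain L where L: "linear L" "\<And>n. L (?v n) = E n"
    using linear_prescribed_on_dirac_powers by metis
  have "\<forall>k. L (dr_even_delta k) = omega_dr_odd_delta k"
    by (simp add: dr_even_delta_def omega_dr_odd_delta_def linear_cmul [OF L(1)] L(2) E_def
        del: funpow.simps)
  moreover have "\<forall>k. L (omega_dr_odd_delta k) = - dr_even_delta (k + 1)"
    by (simp add: dr_even_delta_def omega_dr_odd_delta_def linear_cmul [OF L(1)] L(2) E_def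
        radial_coeff_nonzero del: funpow.simps)
  ultimately have "\<exists>L :: 'n distribution \<Rightarrow> 'n distribution. linear L \<and>
    (\<forall>k. L (dr_even_delta k) = omega_dr_odd_delta k) \<and>
    (\<forall>k. L (omega_dr_odd_delta k) = - dr_even_delta (k + 1))"
    using L(1) by blast
  from someI_ex [OF this, folded omega_dr_def]
  show "linear (omega_dr :: 'n distribution \<Rightarrow> 'n distribution)"
    "omega_dr (dr_even_delta k) = (omega_dr_odd_delta k :: 'n distribution)"
    "omega_dr (omega_dr_odd_delta k) = - (dr_even_delta (k + 1) :: 'n distribution)"
    by blast+
qed

lemma inv_vec_prescribed:
  "linear (inv_vec c\<^sub>0 :: 'n::{finite,linorder} distribution \<Rightarrow> 'n distribution)"
  "inv_vec c\<^sub>0 ((dirac ^^ (2 * k)) delta)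
    = (1 / (real CARD('n) + 2 * real k)) *\<^sub>R (dirac ^^ (2 * k + 1)) (delta :: 'n distribution)"
  "inv_vec c\<^sub>0 ((dirac ^^ (2 * k + 1)) delta)
    = (1 / (2 * real k + 2)) *\<^sub>R (dirac ^^ (2 * k + 2)) delta + c\<^sub>0 *\<^sub>R (delta :: 'n distribution)"
proof -
  let ?v = "\<lambda>n. (dirac ^^ n) delta :: 'n distribution"
  define E where "E n = (if even n then (1 / (real CARD('n) + real n)) *\<^sub>R ?v (n + 1)
    else (1 / (real n + 1)) *\<^sub>R ?v (n + 1) + c\<^sub>0 *\<^sub>R ?v 0)" for n
  have v: "?v n \<in> span (range ?v)" for n
    by (rule span_base) simp
  have "E n \<in> span (range ?v)" for n
    using v [of "n + 1"] v [of 0] by (simp add: E_def span_add span_scale del: funpow.simps)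
  then obtain L where L: "linear L" "\<And>n. L (?v n) = E n"
    using linear_prescribed_on_dirac_powers by metis
  have "\<forall>k. L (?v (2 * k)) = (1 / (real CARD('n) + 2 * real k)) *\<^sub>R ?v (2 * k + 1)"
    by (simp add: L(2) E_def del: funpow.simps)
  moreover have "\<forall>k. L (?v (2 * k + 1)) = (1 / (2 * real k + 2)) *\<^sub>R ?v (2 * k + 2) + c\<^sub>0 *\<^sub>R delta"
  proof
    fix k
    have "L (?v (2 * k + 1)) = E (2 * k + 1)"
      by (rule L(2))
    then show "L (?v (2 * k + 1)) = (1 / (2 * real k + 2)) *\<^sub>R ?v (2 * k + 2) + c\<^sub>0 *\<^sub>R delta"
      by (simp add: E_def add_ac)
  qed
  ultimately have "\<exists>L. linear L \<and>
    (\<forall>k. L (?v (2 * k)) = (1 / (real CARD('n) + 2 * real k)) *\<^sub>R ?v (2 * k + 1)) \<and>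
    (\<forall>k. L (?v (2 * k + 1)) = (1 / (2 * real k + 2)) *\<^sub>R ?v (2 * k + 2) + c\<^sub>0 *\<^sub>R delta)"
    using L(1) by blast
  from someI_ex [OF this, folded inv_vec_def]
  show "linear (inv_vec c\<^sub>0 :: 'n distribution \<Rightarrow> 'n distribution)"
    "inv_vec c\<^sub>0 (?v (2 * k)) = (1 / (real CARD('n) + 2 * real k)) *\<^sub>R ?v (2 * k + 1)"
    "inv_vec c\<^sub>0 (?v (2 * k + 1)) = (1 / (2 * real k + 2)) *\<^sub>R ?v (2 * k + 2) + c\<^sub>0 *\<^sub>R delta"
    by blast+
qed

section \<open>The six identities\<close>

lemma inv_omega_mult: "inv omega_mult (omega_mult T) = T"
  by (rule inv_f_f [OF bij_is_inj [OF bij_omega_mult]])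

lemma omega_mult_uminus: "omega_mult (- T) = - omega_mult T"
  by (simp add: pairing_inject [symmetric] fun_eq_iff omega_mult.rep_eq uminus_cont_linear.rep_eq)

lemma dr_odd_delta_eq_omega_mult: "dr_odd_delta k = omega_mult (- omega_dr_odd_delta k)"
  by (simp add: dr_odd_delta_def omega_mult_uminus)

lemma vec_mult_omega_dr_odd_delta:
  "vec_mult (omega_dr_odd_delta k)
    = (real CARD('n) + 2 * real k) *\<^sub>R (dr_even_delta k :: 'n::{finite,linorder} distribution)"
  using vec_mult_dirac_power_delta [of "2 * k", where 'n='n]
  by (simp add: omega_dr_odd_delta_def dr_even_delta_def linear_cmul [OF linear_vec_mult]
      lowering_coeff_def mult.commute del: funpow.simps)

lemma vec_mult_dr_even_delta:
  "vec_mult (dr_even_delta (Suc k))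
    = - (real CARD('n) + 2 * real k + 1) *\<^sub>R (omega_dr_odd_delta k :: 'n::{finite,linorder} distribution)"
proof -
  have "vec_mult (dr_even_delta (Suc k) :: 'n distribution)
    = ((2 * real k + 2) * radial_coeff CARD('n) (Suc k)) *\<^sub>R (dirac ^^ (2 * k + 1)) delta"
    using vec_mult_dirac_power_delta [of "2 * k + 1", where 'n='n]
    by (simp add: dr_even_delta_def linear_cmul [OF linear_vec_mult] lowering_coeff_def algebra_simps
        del: funpow.simps)
  then show ?thesis
    by (simp add: radial_coeff_Suc omega_dr_odd_delta_def del: funpow.simps)
qed

text \<open>
  The coefficients of \<open>1/x\<close> are the reciprocals of those with which \<open>x\<close> lowers the powers of \<open>\<partial>\<close>, and the
  free term \<open>c\<^sub>0 \<delta>\<close> lies in the kernel of \<open>x\<close>.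
\<close>

lemma vec_mult_inv_vec_dirac_power:
  "vec_mult (inv_vec c\<^sub>0 ((dirac ^^ n) delta)) = (dirac ^^ n) (delta :: 'n::{finite,linorder} distribution)"
proof -
  note lin = linear_cmul [OF linear_vec_mult] linear_add [OF linear_vec_mult]
  note low = vec_mult_dirac_power_delta [where 'n='n, unfolded lowering_coeff_def]
  consider k where "n = 2 * k" | k where "n = 2 * k + 1"
    by (metis evenE oddE)
  then show ?thesis
  proof cases
    case 1
    have "real CARD('n) + 2 * real k \<noteq> 0"
      using zero_less_card_finite [where 'a='n] by (smt (verit) of_nat_0_le_iff of_nat_0_less_iff)
    then show ?thesis
      using 1 low [of n] by (simp add: inv_vec_prescribed lin del: funpow.simps)
  next
    case 2
    have "vec_mult ((dirac ^^ (2 * k + 2)) (delta :: 'n distribution))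
      = (2 * real k + 2) *\<^sub>R (dirac ^^ (2 * k + 1)) delta"
      using low [of "2 * k + 1"] by (simp add: add_ac del: funpow.simps)
    then show ?thesis
      unfolding 2 inv_vec_prescribed lin vec_mult_delta by (simp del: funpow.simps)
  qed
qed

theorem mainTheorem2:
  shows "(\<forall>k. r_mult (dr_odd_delta k :: 'n::{finite,linorder} signumdistribution)
            = - (real CARD('n) + 2 * real k) *\<^sub>R dr_even_delta k)
    \<and> (\<forall>k\<ge>1. r_mult (omega_dr_even_delta k :: 'n signumdistribution)
            = - (real CARD('n) + 2 * real k - 1) *\<^sub>R omega_dr_odd_delta (k - 1))
    \<and> (\<forall>c\<^sub>0 k. r_mult (inv_r c\<^sub>0 (dr_even_delta k :: 'n distribution)) = dr_even_delta k)
    \<and> (\<forall>c\<^sub>0 k. r_mult (inv_r c\<^sub>0 (omega_dr_odd_delta k :: 'n distribution)) = omega_dr_odd_delta k)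
    \<and> (\<forall>k. dr (dr_odd_delta k :: 'n signumdistribution) = dr_even_delta (k + 1))
    \<and> (\<forall>k. dr (omega_dr_even_delta k :: 'n signumdistribution) = omega_dr_odd_delta k)"
proof (intro conjI allI impI)
  fix k :: nat and c\<^sub>0 :: real
  show "r_mult (dr_odd_delta k :: 'n signumdistribution)
      = - (real CARD('n) + 2 * real k) *\<^sub>R dr_even_delta k"
    unfolding r_mult_def dr_odd_delta_eq_omega_mult inv_omega_mult linear_neg [OF linear_vec_mult]
      vec_mult_omega_dr_odd_delta scaleR_minus_left ..
  show "r_mult (omega_dr_even_delta k :: 'n signumdistribution)
      = - (real CARD('n) + 2 * real k - 1) *\<^sub>R omega_dr_odd_delta (k - 1)" if "k \<ge> 1"
  proof -
    obtain l where "k = Suc l"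
      using \<open>k \<ge> 1\<close> by (cases k) auto
    then show ?thesis
      by (simp add: r_mult_def omega_dr_even_delta_def inv_omega_mult vec_mult_dr_even_delta add_ac)
  qed
  show "r_mult (inv_r c\<^sub>0 (dr_even_delta k :: 'n distribution)) = dr_even_delta k"
    "r_mult (inv_r c\<^sub>0 (omega_dr_odd_delta k :: 'n distribution)) = omega_dr_odd_delta k"
    unfolding r_mult_def inv_r_def inv_omega_mult dr_even_delta_def omega_dr_odd_delta_def
      linear_cmul [OF inv_vec_prescribed(1)] linear_cmul [OF linear_vec_mult] vec_mult_inv_vec_dirac_power
    by (rule refl)+
  show "dr (dr_odd_delta k :: 'n signumdistribution) = dr_even_delta (k + 1)"
    unfolding dr_def dr_odd_delta_eq_omega_mult inv_omega_mult linear_neg [OF omega_dr_prescribed(1)]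
      omega_dr_prescribed by simp
  show "dr (omega_dr_even_delta k :: 'n signumdistribution) = omega_dr_odd_delta k"
    unfolding dr_def omega_dr_even_delta_def inv_omega_mult by (rule omega_dr_prescribed)
qed

end
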